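(* Let $p(\cdot)\in\mathcal{P}(\mathbb{R})$ satisfy at least one of: $p_+<\infty$; or $1/p(\cdot)$ is log-Hölder continuous at infinity with limit $1$. Fix $f\in L^{p(\cdot)}(\mathbb{R})$. For any function $g:\mathbb{R}\to\mathbb{C}$ denote $\tau_ag(x)=g(x-a)$ and $\tilde{g}(x)=g(-x)$, for all $a,x\in\mathbb{R}$. Then: (1) The Fourier transform is a bounded linear isomorphism and isometry $\mathcal{F}:L^{p(\cdot)}(\mathbb{R})\to\mathcal{A}_{p(\cdot)}(\mathbb{R})$, that is, $\|\widehat{f}\|_{\mathcal{A}_{p(\cdot)}(\mathbb{R})}=\|f\|_{p(\cdot)}$; (2) $\widehat{f}^{(n)}=\Psi_f^{(n+1)}$ for $n\in\mathbb{N}$ (distributional derivatives); (3) for $a\in\mathbb{R}$, $\widehat{\tau_af}=\Psi_{\tau_af}'$, and $\Psi_{\tau_af}(s)=f*\tilde{u}_s(-a)$; (4) for $a\in\mathbb{R}$ and $F(t)=e^{iat}f(t)$, $\widehat{F}=(\tau_a\Psi_f)'$; (5) $\widehat{\tilde{f}}=\Psi_{\tilde{f}}'$, and $\Psi_{\tilde{f}}=-\widetilde{\Psi_f}$; (6) if $\widehat{f}\in L^{r(\cdot)}(\mathbb{R})$ for some $r(\cdot)\in\mathcal{P}(\mathbb{R})$ such that $r_+<\infty$ or $1/r(\cdot)$ is log-Hölder continuous at infinity with limit $1$, then $\widehat{\widehat{f}}=\Psi_{\widehat{f}}'$; (7) let $g(x)=f(ax+b)$ for $a,b\in\mathbb{R}$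 with $a\neq0$. Then $\widehat{g}=\Psi_g'$, where $\Psi_g(s)=\operatorname{sgn}(a)\,\Psi_{\tau_{-b}f}(s/a)$.
   Context: $\mathcal{P}(\mathbb{R})$ is the set of measurable functions $p(\cdot):\mathbb{R}\to[1,\infty]$ (exponent functions), and $p_-=\operatorname{ess\,inf} p$, $p_+=\operatorname{ess\,sup} p$. Convention: $1/\infty=0$. "$1/p(\cdot)$ is log-Hölder continuous at infinity with limit $1$" means: there is $C>0$ with $\left|\frac{1}{p(x)}-1\right|\le \frac{C}{\log(e+|x|)}$ for almost every $x\in\mathbb{R}$. Let $\mathbb{R}_\infty^{p(\cdot)}=\{x: p(x)=\infty\}$. The modular is $\rho_{p(\cdot)}(f)=\int_{\mathbb{R}\setminus \mathbb{R}_\infty^{p(\cdot)}}|f(x)|^{p(x)}dx+\|f\|_{L^\infty(\mathbb{R}_\infty^{p(\cdot)})}\in[0,\infty]$. $L^{p(\cdot)}(\mathbb{R})$ is the space of (complex-valued) Lebesgue measurable functions $f$ on $\mathbb{R}$, identified when equal almost everywhere, with $\rho_{p(\cdot)}(f/\lambda)<\infty$ for some $\lambda>0$, with norm $\|f\|_{p(\cdot)}=\inf\{\lambda>0:\rho_{p(\cdot)}(f/\lambda)\le 1\}$. Let $u_s(t)=\frac{1-e^{-ist}}{it}$ for $s,t\in\mathbb{R}\setminus\{0\}$. Define $\Psi_f(s)=\int_{-\infty}^{\infty}\left(\frac{1-e^{-ist}}{it}\right)f(t)\,dt$ for $s\ne0$ (whenever the integral is well defined) and $\Psi_f(0)=0$.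 For an exponent $p(\cdot)$ with $p_+<\infty$ or $1/p(\cdot)$ log-Hölder continuous at infinity with limit $1$, and $f\in L^{p(\cdot)}(\mathbb{R})$, the Fourier transform of $f$ is the tempered distribution $\mathcal{F}(f)=\widehat{f}:=\Psi_f'$ (distributional derivative), i.e. $\langle\widehat f,\varphi\rangle=-\int_{-\infty}^\infty\Psi_f(s)\varphi'(s)\,ds$ for $\varphi\in\mathcal{S}(\mathbb{R})$. $\mathcal{A}_{p(\cdot)}(\mathbb{R})=\{\Psi_f':f\in L^{p(\cdot)}(\mathbb{R})\}$ with norm $\|\Psi_f'\|_{\mathcal{A}_{p(\cdot)}(\mathbb{R})}:=\|f\|_{p(\cdot)}$. $*$ denotes convolution on $\mathbb{R}$. *)

theory Defs
  imports "HOL-Probability.Essential_Supremum"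
begin

section \<open>Variable Lebesgue spaces on the real line\<close>

definition exponents :: "(real \<Rightarrow> ennreal) set" where
  "exponents = {p. p \<in> borel_measurable lebesgue \<and> (\<forall>x. 1 \<le> p x)}"

definition log_holder_at_infinity_1 :: "(real \<Rightarrow> ennreal) \<Rightarrow> bool" where
  "log_holder_at_infinity_1 p \<longleftrightarrow>
     (\<exists>C>0. AE x in lebesgue. \<bar>enn2real (1 / p x) - 1\<bar> \<le> C / ln (exp 1 + \<bar>x\<bar>))"

definition admissible :: "(real \<Rightarrow> ennreal) \<Rightarrow> bool" where
  "admissible p \<longleftrightarrow> p \<in> exponents \<and> (esssup lebesgue p < \<infinity> \<or> log_holder_at_infinity_1 p)"

text \<open>The second summand is the \<open>L\<^sup>\<infinity>\<close> norm over the set where \<open>p = \<infinity>\<close>. The supremum is taken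
  in \<open>[0, \<infinity>]\<close> so that it is \<open>0\<close> (not \<open>-\<infinity>\<close>) when that set is null.\<close>

definition modular :: "(real \<Rightarrow> ennreal) \<Rightarrow> (real \<Rightarrow> complex) \<Rightarrow> ennreal" where
  "modular p f =
     (\<integral>\<^sup>+x\<in>{x. p x \<noteq> \<infinity>}. ennreal (norm (f x) powr enn2real (p x)) \<partial>lebesgue)
     + esssup (restrict_space lebesgue {x. p x = \<infinity>}) (\<lambda>x. ennreal (norm (f x)))"

text \<open>Elements of \<open>L\<^sup>p\<close> are represented by functions; identification almost everywhere is made
  explicit where equality in \<open>L\<^sup>p\<close> matters.\<close>

definition Lp :: "(real \<Rightarrow> ennreal) \<Rightarrow> (real \<Rightarrow> complex) set" where
  "Lp p = {f \<in> borel_measurable lebesgue. \<exists>l>0. modular p (\<lambda>x. f x / complex_of_real l) < \<infinity>}"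

definition Lp_norm :: "(real \<Rightarrow> ennreal) \<Rightarrow> (real \<Rightarrow> complex) \<Rightarrow> real" where
  "Lp_norm p f = Inf {l. l > 0 \<and> modular p (\<lambda>x. f x / complex_of_real l) \<le> 1}"


section \<open>Tempered distributions\<close>

definition vderiv :: "(real \<Rightarrow> complex) \<Rightarrow> real \<Rightarrow> complex" where
  "vderiv \<phi> = (\<lambda>x. vector_derivative \<phi> (at x))"

definition schwartz :: "(real \<Rightarrow> complex) set" where
  "schwartz = {\<phi>. (\<forall>n x. (vderiv ^^ n) \<phi> differentiable (at x)) \<and>
                  (\<forall>k n. bdd_above (range (\<lambda>x. \<bar>x\<bar> ^ k * norm ((vderiv ^^ n) \<phi> x))))}"

definition schwartz_seminorm :: "nat \<Rightarrow> nat \<Rightarrow> (real \<Rightarrow> complex) \<Rightarrow> real" where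
  "schwartz_seminorm k n \<phi> = (SUP x. \<bar>x\<bar> ^ k * norm ((vderiv ^^ n) \<phi> x))"

type_synonym functional = "(real \<Rightarrow> complex) \<Rightarrow> complex"

text \<open>Functionals on the Schwartz space are extended by \<open>0\<close> to all functions, so that HOL equality
  is equality of functionals on Schwartz functions. The last clause is continuity for the topology
  generated by the seminorms.\<close>

definition tempered_distributions :: "functional set" where
  "tempered_distributions = {T.
     (\<forall>\<phi>. \<phi> \<notin> schwartz \<longrightarrow> T \<phi> = 0) \<and>
     (\<forall>\<phi>\<in>schwartz. \<forall>\<psi>\<in>schwartz. \<forall>c d. T (\<lambda>x. c * \<phi> x + d * \<psi> x) = c * T \<phi> + d * T \<psi>) \<and>
     (\<forall>\<phi>\<in>schwartz. \<forall>\<epsilon>>0. \<exists>N. \<exists>\<delta>>0. \<forall>\<psi>\<in>schwartz.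
        (\<forall>k\<le>N. \<forall>n\<le>N. schwartz_seminorm k n (\<lambda>x. \<psi> x - \<phi> x) < \<delta>) \<longrightarrow> norm (T \<psi> - T \<phi>) < \<epsilon>)}"

definition regular :: "(real \<Rightarrow> complex) \<Rightarrow> functional" where
  "regular g = (\<lambda>\<phi>. if \<phi> \<in> schwartz then (LINT x|lebesgue. g x * \<phi> x) else 0)"

definition dist_deriv :: "functional \<Rightarrow> functional" where
  "dist_deriv T = (\<lambda>\<phi>. if \<phi> \<in> schwartz then - T (vderiv \<phi>) else 0)"


section \<open>The Fourier transform\<close>

definition translate :: "real \<Rightarrow> (real \<Rightarrow> 'a) \<Rightarrow> real \<Rightarrow> 'a" where
  "translate a g = (\<lambda>x. g (x - a))"

definition reflect :: "(real \<Rightarrow> 'a) \<Rightarrow> real \<Rightarrow> 'a" where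
  "reflect g = (\<lambda>x. g (- x))"

definition conv :: "(real \<Rightarrow> complex) \<Rightarrow> (real \<Rightarrow> complex) \<Rightarrow> real \<Rightarrow> complex" where
  "conv f g x = (LINT t|lebesgue. f t * g (x - t))"

text \<open>The value \<open>0\<close> at \<open>t = 0\<close> produced by division by zero is irrelevant: \<open>u_fun s\<close> only occurs
  under integrals.\<close>

definition u_fun :: "real \<Rightarrow> real \<Rightarrow> complex" where
  "u_fun s t = (1 - exp (- (\<i> * complex_of_real s * complex_of_real t))) / (\<i> * complex_of_real t)"

definition Psi :: "(real \<Rightarrow> complex) \<Rightarrow> real \<Rightarrow> complex" where
  "Psi f s = (if s = 0 then 0 else (LINT t|lebesgue. u_fun s t * f t))"

definition fourier_domain :: "(real \<Rightarrow> complex) set" where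
  "fourier_domain = (\<Union>p\<in>{p. admissible p}. Lp p)"

definition fourier :: "(real \<Rightarrow> complex) \<Rightarrow> functional" where
  "fourier f = (if f \<in> fourier_domain then dist_deriv (regular (Psi f)) else undefined)"

text \<open>The Fourier transform of a distribution that is given by a function in some admissible
  \<open>L\<^sup>r\<close>: transform any function representing it.\<close>

definition fourier_dist :: "functional \<Rightarrow> functional" where
  "fourier_dist T = fourier (SOME h. h \<in> fourier_domain \<and> regular h = T)"

definition A_space :: "(real \<Rightarrow> ennreal) \<Rightarrow> functional set" where
  "A_space p = {dist_deriv (regular (Psi f)) | f. f \<in> Lp p}"

definition A_norm :: "(real \<Rightarrow> ennreal) \<Rightarrow> functional \<Rightarrow> real" where
  "A_norm p T = Lp_norm p (SOME f. f \<in> Lp p \<and> dist_deriv (regular (Psi f)) = T)"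

end

theory Submission
  imports Defs "HOL-Probability.Probability"
begin

text \<open>
  Everything rests on one consequence of the hypothesis on the exponent: every \<open>h\<close> in \<open>L\<^sup>p\<close> is
  integrable against the weight \<open>1/(1 + \<bar>t\<bar>)\<close> (lemma \<open>Lp_imp_tame\<close>). If \<open>p\<close> is essentially bounded,
  or if \<open>1/p\<close> tends to \<open>1\<close> at logarithmic speed, then the weight raised to the conjugate exponent
  \<open>p'\<close> is dominated by a multiple of \<open>(1 + \<bar>t\<bar>) powr - a\<close> for some \<open>a > 1\<close>, and a pointwise Young
  inequality finishes the argument. Functions with this weighted integrability are called \<open>tame\<close>
  below, and the analysis of \<open>Psi\<close> is carried out for them.

  The kernel satisfies \<open>\<bar>u\<^sub>s(t)\<bar> \<le> (2 + \<bar>s\<bar>)/(1 + \<bar>t\<bar>)\<close>. Hence, for tame \<open>h\<close>, \<open>Psi h\<close> is given by an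
  absolutely convergent integral, is continuous, and grows at most linearly; so it is a tempered
  distribution, and so is its derivative. The formulas for translates, reflections and dilations
  are changes of variables in the integral. For modulations the two primitives differ by a constant,
  which differentiation removes.

  The substantial point is that the transform is injective modulo null sets; without this the norm
  of the image space, defined by choosing a preimage, would not be known to equal the norm of
  \<open>h\<close>. By Fubini and an integration by parts in \<open>s\<close>, where \<open>u\<^sub>s(t)\<close> has derivative \<open>exp (- i s t)\<close>,
  the derivative of \<open>Psi h\<close> sends a Schwartz function to the integral of \<open>h\<close> against its classical
  Fourier transform (lemma \<open>dist_deriv_Psi_eq_integral_fourier\<close>). Testing with shifted Gaussians,
  whose transforms are modulated Gaussians, shows that if the distribution vanishes then the
  integrable function \<open>h(t) exp(-t\<^sup>2/2)\<close> has vanishing Fourier transform. By Levy's uniqueness theorem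
  for characteristic functions, applied to the positive and negative parts, \<open>h\<close> vanishes almost
  everywhere. Used as test functions themselves, modulated Gaussians show that a tame function
  is determined by the regular distribution that it defines, which makes the iterated transform
  independent of the chosen representative.
\<close>

section \<open>Functions integrable with respect to \<open>dt/(1 + \<bar>t\<bar>)\<close>\<close>

lemma integrable_one_plus_abs_powr:
  fixes a :: real
  assumes "a > 1"
  shows "integrable lebesgue (\<lambda>t::real. (1 + \<bar>t\<bar>) powr - a)"
proof -
  \<comment> \<open>The weight is at most the sum of two reflected and shifted copies of the tail \<open>g\<close>.\<close>
  define g where "g = (\<lambda>x::real. indicator {1..} x *\<^sub>R x powr - a)"
  have "(\<lambda>x. x powr - a) integrable_on {1..}"
    using has_integral_powr_to_inf[of "- a" 1] assms by (auto simp: integrable_on_def)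
  then have "(\<lambda>x. x powr - a) absolutely_integrable_on {1..}"
    by (rule nonnegative_absolutely_integrable_1) auto
  then have g: "integrable lebesgue g" by (simp add: set_integrable_def g_def)
  have "integrable lebesgue (\<lambda>t. g (1 + 1 * t) + g (1 + (- 1) * t))"
    using lebesgue_integrable_real_affine_iff[of 1 g 1]
      lebesgue_integrable_real_affine_iff[of "-1" g 1] g by simp
  then show ?thesis
  proof (rule Bochner_Integration.integrable_bound)
    show "(\<lambda>t::real. (1 + \<bar>t\<bar>) powr - a) \<in> borel_measurable lebesgue"
      by (rule measurable_completion) measurable
  qed (auto simp: g_def indicator_def)
qed

text \<open>The weighted space \<open>L\<^sup>1(dt/(1 + \<bar>t\<bar>))\<close>. The weight is chosen to match the kernel \<open>u_fun s\<close>, which is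
  bounded near \<open>0\<close> and of size at most \<open>2/\<bar>t\<bar>\<close> at infinity.\<close>

definition tame :: "(real \<Rightarrow> complex) \<Rightarrow> bool" where
  "tame h \<longleftrightarrow> integrable lebesgue (\<lambda>t. h t / complex_of_real (1 + \<bar>t\<bar>))"

definition tame_norm :: "(real \<Rightarrow> complex) \<Rightarrow> real" where
  "tame_norm h = (LINT t|lebesgue. norm (h t / complex_of_real (1 + \<bar>t\<bar>)))"

lemma tame_measurable:
  assumes "tame h"
  shows "h \<in> borel_measurable lebesgue"
proof -
  have "(\<lambda>t. h t / complex_of_real (1 + \<bar>t\<bar>)) \<in> borel_measurable lebesgue"
    using assms by (auto simp: tame_def)
  moreover have "(\<lambda>t. complex_of_real (1 + \<bar>t\<bar>)) \<in> borel_measurable lebesgue"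
    by (rule measurable_completion) measurable
  ultimately have "(\<lambda>t. h t / complex_of_real (1 + \<bar>t\<bar>) * complex_of_real (1 + \<bar>t\<bar>)) \<in> borel_measurable lebesgue"
    by (rule borel_measurable_times)
  moreover have "h t / complex_of_real (1 + \<bar>t\<bar>) * complex_of_real (1 + \<bar>t\<bar>) = h t" for t
  proof -
    have "complex_of_real (1 + \<bar>t\<bar>) \<noteq> 0" by (subst of_real_eq_0_iff) simp
    then show ?thesis by simp
  qed
  ultimately show ?thesis by simp
qed

lemma norm_tame_weight: "norm (h t / complex_of_real (1 + \<bar>t\<bar>)) = norm (h t) / (1 + \<bar>t\<bar>)"
  unfolding norm_divide norm_of_real by simp

lemma tame_norm_integrable: "tame h \<Longrightarrow> integrable lebesgue (\<lambda>t. norm (h t) / (1 + \<bar>t\<bar>))"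
  using integrable_norm[of lebesgue "\<lambda>t. h t / complex_of_real (1 + \<bar>t\<bar>)"]
  by (simp only: tame_def norm_tame_weight)

lemma tame_iff:
  "tame h \<longleftrightarrow> h \<in> borel_measurable lebesgue \<and> integrable lebesgue (\<lambda>t. norm (h t) / (1 + \<bar>t\<bar>))"
proof
  assume r: "h \<in> borel_measurable lebesgue \<and> integrable lebesgue (\<lambda>t. norm (h t) / (1 + \<bar>t\<bar>))"
  show "tame h" unfolding tame_def
  proof (rule Bochner_Integration.integrable_bound)
    show "integrable lebesgue (\<lambda>t. norm (h t) / (1 + \<bar>t\<bar>))" using r by simp
    have "(\<lambda>t. complex_of_real (1 + \<bar>t\<bar>)) \<in> borel_measurable lebesgue"
      by (rule measurable_completion) measurable
    then show "(\<lambda>t. h t / complex_of_real (1 + \<bar>t\<bar>)) \<in> borel_measurable lebesgue"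
      using r by (intro borel_measurable_divide) auto
  qed (simp add: norm_tame_weight del: of_real_add)
qed (simp add: tame_measurable tame_norm_integrable)

lemma tame_norm_nonneg: "0 \<le> tame_norm h"
  by (simp add: tame_norm_def)

lemma tame_diff: "tame h \<Longrightarrow> tame k \<Longrightarrow> tame (\<lambda>x. h x - k x)"
  unfolding tame_def diff_divide_distrib by (rule Bochner_Integration.integrable_diff)

text \<open>Fubini's theorem and Levy's theorem are about Borel measurable functions; a Lebesgue measurable
  function is replaced by an almost everywhere equal Borel one before they are applied.\<close>

lemma borel_representative:
  fixes h :: "real \<Rightarrow> complex"
  assumes "h \<in> borel_measurable lebesgue"
  obtains h' where "h' \<in> borel_measurable borel" "AE x in lebesgue. h x = h' x"
proof -
  have "(\<lambda>x. Re (h x)) \<in> borel_measurable lebesgue" "(\<lambda>x. Im (h x)) \<in> borel_measurable lebesgue"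
    using assms by auto
  then obtain a b where ab: "a \<in> borel_measurable lborel" "b \<in> borel_measurable lborel"
    "AE x in lborel. Re (h x) = a x" "AE x in lborel. Im (h x) = b x"
    using completion_ex_borel_measurable_real by metis
  note [measurable] = ab(1,2)
  have "AE x in lborel. h x = complex_of_real (a x) + \<i> * complex_of_real (b x)"
    using ab(3,4) by eventually_elim (simp add: complex_eq_iff)
  then show thesis
    by (intro that[of "\<lambda>x. complex_of_real (a x) + \<i> * complex_of_real (b x)"] AE_completion) auto
qed

lemma tame_cong_AE:
  assumes "tame h" "k \<in> borel_measurable lebesgue" "AE x in lebesgue. h x = k x"
  shows "tame k"
proof -
  have m: "(\<lambda>t. norm (g t) / (1 + \<bar>t\<bar>)) \<in> borel_measurable lebesgue"
    if "g \<in> borel_measurable lebesgue" for g :: "real \<Rightarrow> complex"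
  proof -
    have "(\<lambda>t::real. 1 + \<bar>t\<bar>) \<in> borel_measurable lebesgue" by (rule measurable_completion) measurable
    then show ?thesis using that by (intro borel_measurable_divide) auto
  qed
  have "integrable lebesgue (\<lambda>t. norm (k t) / (1 + \<bar>t\<bar>))"
    using assms m[of h] m[of k] tame_norm_integrable[OF assms(1)]
    by (subst integrable_cong_AE[of _ _ "\<lambda>t. norm (h t) / (1 + \<bar>t\<bar>)"]) (auto simp: tame_iff)
  then show ?thesis using assms by (simp add: tame_iff)
qed

lemma tame_borel_representative:
  assumes "tame h"
  obtains h' where "h' \<in> borel_measurable borel" "tame h'" "AE x in lebesgue. h x = h' x"
proof -
  obtain h' where h': "h' \<in> borel_measurable borel" "AE x in lebesgue. h x = h' x"
    using borel_representative[OF tame_measurable[OF assms]] .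
  moreover have "tame h'"
    by (rule tame_cong_AE[OF assms _ h'(2)]) (rule measurable_completion, use h' in simp)
  ultimately show thesis using that by blast
qed

section \<open>The variable Lebesgue spaces lie in the weighted space\<close>

text \<open>Here \<open>1 / (1 - 1 / p)\<close> is the conjugate exponent. Either \<open>v \<le> g powr (p - 1)\<close>, and then the product
  is at most \<open>g powr p\<close>, or \<open>g\<close> is smaller than \<open>v powr (1 / (p - 1))\<close>, and then it is at most the
  conjugate power of \<open>v\<close>.\<close>

lemma young_crude:
  fixes g v p :: real
  assumes "0 \<le> g" "0 < v" "1 < p"
  shows "g * v \<le> g powr p + v powr (1 / (1 - 1 / p))"
proof (cases "v \<le> g powr (p - 1)")
  case True
  have "g * v \<le> g * g powr (p - 1)" using True assms by (intro mult_left_mono) auto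
  also have "\<dots> = g powr p" using assms by (cases "g = 0") (auto simp: powr_mult_base)
  finally show ?thesis by (smt (verit) powr_ge_zero)
next
  case False
  have "g = (g powr (p - 1)) powr (1 / (p - 1))" using assms by (simp add: powr_powr)
  also have "\<dots> \<le> v powr (1 / (p - 1))" using False assms by (intro powr_mono2) auto
  finally have "g * v \<le> v powr (1 / (p - 1)) * v" using assms by (intro mult_right_mono) auto
  also have "\<dots> = v powr (1 + 1 / (p - 1))" using assms by (simp add: powr_add)
  also have "1 + 1 / (p - 1) = 1 / (1 - 1 / p)" using assms by (simp add: field_simps)
  finally show ?thesis by (smt (verit) powr_ge_zero)
qed

text \<open>The weight raised to the conjugate exponent \<open>p'\<close> is integrable at infinity. Where \<open>p = \<infinity>\<close> the formula
  gives \<open>p' = 1\<close>, as it should. If \<open>p \<le> P\<close>, then \<open>p'\<close> is at least the conjugate of \<open>P\<close>, which is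
  greater than \<open>1\<close>. In the log-Hoelder case \<open>p' \<ge> l / C\<close> with \<open>l = ln (1 + \<bar>t\<bar>)\<close>, so the power is at most
  \<open>exp (- l\<^sup>2 / C)\<close>, and \<open>2 l \<le> C + l\<^sup>2 / C\<close> turns this into quadratic decay.\<close>

lemma admissible_conjugate_decay:
  assumes "admissible p"
  obtains a c :: real where "a > 1" "c > 0"
    "AE t in lebesgue. p t \<noteq> 1 \<longrightarrow>
       (1 + \<bar>t\<bar>) powr - (1 / (1 - enn2real (1 / p t))) \<le> c * (1 + \<bar>t\<bar>) powr - a"
proof -
  have p1: "1 \<le> p t" for t using assms by (auto simp: admissible_def exponents_def)
  have inverse_less_1: "enn2real (1 / p t) < 1" if "p t \<noteq> 1" for t
  proof (cases "p t")
    case (real r)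
    then have "1 < r" using p1[of t] that by (metis ennreal_1 ennreal_le_iff ennreal_less_iff less_le zero_le_one)
    then show ?thesis using real by (simp add: divide_ennreal flip: ennreal_1)
  qed auto
  consider "esssup lebesgue p < \<infinity>" | "log_holder_at_infinity_1 p"
    using assms by (auto simp: admissible_def)
  then show thesis
  proof cases
    case 1
    \<comment> \<open>Adding \<open>1\<close> makes \<open>P > 1\<close>, so that its conjugate exponent is finite.\<close>
    define P where "P = enn2real (esssup lebesgue p) + 1"
    have "AE t in lebesgue. p t \<le> esssup lebesgue p" by (rule esssup_AE)
    then have bound: "AE t in lebesgue. p t \<le> ennreal P"
    proof eventually_elim
      case (elim t)
      have "esssup lebesgue p = ennreal (enn2real (esssup lebesgue p))" using 1 by simp
      also have "\<dots> \<le> ennreal P" by (rule ennreal_leI) (simp add: P_def)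
      finally show ?case using elim by simp
    qed
    have P1: "P > 1"
    proof -
      have "1 \<le> esssup lebesgue p"
      proof (rule ccontr)
        assume "\<not> 1 \<le> esssup lebesgue p"
        moreover have "AE t in lebesgue. p t \<le> esssup lebesgue p" by (rule esssup_AE)
        ultimately have "AE t::real in lebesgue. False"
          by (auto elim!: eventually_mono dest: order_trans[OF p1])
        then show False by (simp add: AE_iff_null null_sets_completion_iff) (simp add: null_sets_def)
      qed
      then have "1 \<le> enn2real (esssup lebesgue p)" using enn2real_mono[of 1 "esssup lebesgue p"] 1 by simp
      then show ?thesis by (simp add: P_def)
    qed
    show thesis
    proof (rule that[of "1 / (1 - 1 / P)" 1])
      show "1 / (1 - 1 / P) > 1" using P1 by (simp add: field_simps)
      show "AE t in lebesgue. p t \<noteq> 1 \<longrightarrow>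
        (1 + \<bar>t\<bar>) powr - (1 / (1 - enn2real (1 / p t))) \<le> 1 * (1 + \<bar>t\<bar>) powr - (1 / (1 - 1 / P))"
        using bound
      proof eventually_elim
        case (elim t)
        show ?case
        proof
          assume "p t \<noteq> 1"
          obtain r where r: "p t = ennreal r" "r \<ge> 0"
            using elim by (cases "p t") (auto simp: top_unique)
          have "r \<ge> 1" using r p1[of t] by (simp flip: ennreal_1)
          have "enn2real (1 / p t) = 1 / r" using r \<open>r \<ge> 1\<close> by (simp add: divide_ennreal flip: ennreal_1)
          moreover have "r \<le> P" using elim r P1 by simp
          ultimately have "1 / P \<le> enn2real (1 / p t)"
            using \<open>r \<ge> 1\<close> by (simp add: frac_le)
          then have "1 / (1 - 1 / P) \<le> 1 / (1 - enn2real (1 / p t))"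
            using inverse_less_1[OF \<open>p t \<noteq> 1\<close>] P1 by (intro divide_left_mono mult_pos_pos) auto
          then show "(1 + \<bar>t\<bar>) powr - (1 / (1 - enn2real (1 / p t)))
            \<le> 1 * (1 + \<bar>t\<bar>) powr - (1 / (1 - 1 / P))"
            by (simp only: mult_1) (intro powr_mono, auto)
        qed
      qed
    qed simp
  next
    case 2
    then obtain C where C: "C > 0"
      and lh: "AE t in lebesgue. \<bar>enn2real (1 / p t) - 1\<bar> \<le> C / ln (exp 1 + \<bar>t\<bar>)"
      by (auto simp: log_holder_at_infinity_1_def)
    show thesis
    proof (rule that[of 2 "exp C"])
      show "AE t in lebesgue. p t \<noteq> 1 \<longrightarrow>
        (1 + \<bar>t\<bar>) powr - (1 / (1 - enn2real (1 / p t))) \<le> exp C * (1 + \<bar>t\<bar>) powr - 2"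
        using lh
      proof eventually_elim
        case (elim t)
        show ?case
        proof
          assume "p t \<noteq> 1"
          define th where "th = 1 - enn2real (1 / p t)"
          define l where "l = ln (1 + \<bar>t\<bar>)"
          define L where "L = ln (exp 1 + \<bar>t\<bar>)"
          have th: "0 < th" "th \<le> C / L"
            using inverse_less_1[OF \<open>p t \<noteq> 1\<close>] elim by (auto simp: th_def L_def)
          have l: "0 \<le> l" "l \<le> L" by (auto simp: l_def L_def add_pos_nonneg)
          have "ln (exp 1) \<le> L" unfolding L_def by (subst ln_le_cancel_iff) (auto simp: add_pos_nonneg)
          then have "L > 0" by simp
          have "l / C * th \<le> l / C * (C / L)" using th l C by (intro mult_left_mono) auto
          also have "\<dots> \<le> 1" using l C \<open>L > 0\<close> by simp
          finally have "l / C \<le> 1 / th" using th by (simp add: pos_le_divide_eq)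
          then have "l * (l / C) \<le> l * (1 / th)" using l by (intro mult_left_mono) auto
          moreover have "2 * l \<le> C + l * (l / C)"
          proof -
            have "0 \<le> (l - C)\<^sup>2 / C" using C by simp
            then show ?thesis using C by (simp add: field_simps power2_eq_square)
          qed
          ultimately have "- (l * (1 / th)) \<le> C - 2 * l" by linarith
          then have "exp (- (1 / th) * l) \<le> exp (C + - 2 * l)" by (simp add: mult.commute)
          then show "(1 + \<bar>t\<bar>) powr - (1 / (1 - enn2real (1 / p t)))
            \<le> exp C * (1 + \<bar>t\<bar>) powr - 2"
            by (auto simp: powr_def exp_add exp_diff exp_minus l_def th_def field_simps)
        qed
      qed
    qed simp_all
  qed
qed

lemma Lp_measurable: "h \<in> Lp p \<Longrightarrow> h \<in> borel_measurable lebesgue"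
  by (simp add: Lp_def)

lemma exponent_infinity_set [measurable]:
  "p \<in> exponents \<Longrightarrow> {x. p x = \<infinity>} \<in> sets lebesgue"
proof -
  assume "p \<in> exponents"
  then have [measurable]: "p \<in> borel_measurable lebesgue" by (simp add: exponents_def)
  have "{x \<in> space lebesgue. p x = \<infinity>} \<in> sets lebesgue" by measurable
  then show ?thesis by simp
qed

text \<open>The two summands of the modular, turned into an integrable real function and an almost everywhere
  bound.\<close>

lemma modular_finite_imp:
  assumes p: "p \<in> exponents" and h[measurable]: "h \<in> borel_measurable lebesgue"
    and fin: "modular p h < \<infinity>"
  shows "integrable lebesgue (\<lambda>x. norm (h x) powr enn2real (p x) * indicator {x. p x \<noteq> \<infinity>} x)"
    and "\<exists>M\<ge>0. AE x in lebesgue. p x = \<infinity> \<longrightarrow> norm (h x) \<le> M"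
proof -
  have pm[measurable]: "p \<in> borel_measurable lebesgue" using p by (simp add: exponents_def)
  have S: "{x. p x = \<infinity>} \<in> sets lebesgue" using p by (rule exponent_infinity_set)
  have S'[measurable]: "{x. p x \<noteq> \<infinity>} \<in> sets lebesgue"
    using S sets.compl_sets[of "{x. p x = \<infinity>}" lebesgue] by (simp add: set_diff_eq)
  let ?I = "\<integral>\<^sup>+x\<in>{x. p x \<noteq> \<infinity>}. ennreal (norm (h x) powr enn2real (p x)) \<partial>lebesgue"
  let ?E = "esssup (restrict_space lebesgue {x. p x = \<infinity>}) (\<lambda>x. ennreal (norm (h x)))"
  have fI: "?I < \<infinity>" and fE: "?E < \<infinity>" using fin by (auto simp: modular_def)
  show "integrable lebesgue (\<lambda>x. norm (h x) powr enn2real (p x) * indicator {x. p x \<noteq> \<infinity>} x)"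
  proof (rule integrableI_bounded)
    have "(\<integral>\<^sup>+ x. ennreal (norm (norm (h x) powr enn2real (p x) * indicat_real {x. p x \<noteq> \<infinity>} x)) \<partial>lebesgue) = ?I"
      by (intro nn_integral_cong) (auto simp: indicator_def)
    then show "(\<integral>\<^sup>+ x. ennreal (norm (norm (h x) powr enn2real (p x) * indicat_real {x. p x \<noteq> \<infinity>} x)) \<partial>lebesgue) < \<infinity>"
      using fI by simp
  qed measurable
  have "AE x in restrict_space lebesgue {x. p x = \<infinity>}. ennreal (norm (h x)) \<le> ?E"
    by (rule esssup_AE)
  then have "AE x in lebesgue. p x = \<infinity> \<longrightarrow> ennreal (norm (h x)) \<le> ?E"
    using S by (subst (asm) AE_restrict_space_iff) auto
  moreover have "?E = ennreal (enn2real ?E)" using fE by simp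
  ultimately have "AE x in lebesgue. p x = \<infinity> \<longrightarrow> ennreal (norm (h x)) \<le> ennreal (enn2real ?E)"
    by simp
  then have "AE x in lebesgue. p x = \<infinity> \<longrightarrow> norm (h x) \<le> enn2real ?E"
    by simp
  then show "\<exists>M\<ge>0. AE x in lebesgue. p x = \<infinity> \<longrightarrow> norm (h x) \<le> M"
    using enn2real_nonneg by blast
qed

text \<open>Young's inequality with the weight in the role of the dual function, in three cases: where \<open>1 < p < \<infinity>\<close>
  both terms are integrable by the finiteness of the modular and by the decay of the conjugate
  power; where \<open>p = \<infinity>\<close> the function is bounded and the weight itself has that decay; where
  \<open>p = 1\<close> the function is integrable and the weight is at most \<open>1\<close>.\<close>

lemma Lp_imp_tame:
  assumes adm: "admissible p" and h: "h \<in> Lp p"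
  shows "tame h"
proof -
  have p: "p \<in> exponents" using adm by (simp add: admissible_def)
  have p1: "1 \<le> p t" for t using p by (auto simp: exponents_def)
  have hm[measurable]: "h \<in> borel_measurable lebesgue" using h by (rule Lp_measurable)
  obtain l where l: "l > 0" and fin: "modular p (\<lambda>x. h x / complex_of_real l) < \<infinity>"
    using h by (auto simp: Lp_def)
  define g where "g = (\<lambda>x. h x / complex_of_real l)"
  have gm[measurable]: "g \<in> borel_measurable lebesgue" unfolding g_def by measurable
  note mod = modular_finite_imp[OF p gm fin[folded g_def]]
  obtain M where M: "M \<ge> 0" "AE x in lebesgue. p x = \<infinity> \<longrightarrow> norm (g x) \<le> M" using mod(2) by auto
  obtain a c where ac: "a > 1" "c > 0" and decay: "AE t in lebesgue. p t \<noteq> 1 \<longrightarrow>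
       (1 + \<bar>t\<bar>) powr - (1 / (1 - enn2real (1 / p t))) \<le> c * (1 + \<bar>t\<bar>) powr - a"
    using admissible_conjugate_decay[OF adm] by blast
  let ?R = "\<lambda>t. norm (g t) powr enn2real (p t) * indicator {x. p x \<noteq> \<infinity>} t
               + (1 + M) * (c * (1 + \<bar>t\<bar>) powr - a)"
  have R: "integrable lebesgue ?R"
    using mod(1) integrable_one_plus_abs_powr[OF ac(1)] by auto
  have "AE t in lebesgue. norm (g t / complex_of_real (1 + \<bar>t\<bar>)) \<le> norm (?R t)"
    using M(2) decay
  proof eventually_elim
    case (elim t)
    define v where "v = inverse (1 + \<bar>t\<bar>)"
    have v: "0 < v" "v \<le> 1" by (auto simp: v_def field_simps)
    have vp: "v powr x = (1 + \<bar>t\<bar>) powr - x" for x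
      by (simp add: v_def powr_minus inverse_powr)
    have nonneg: "0 \<le> c * (1 + \<bar>t\<bar>) powr - a" using ac by auto
    have lhs: "norm (g t / complex_of_real (1 + \<bar>t\<bar>)) = norm (g t) * v"
      unfolding norm_divide norm_of_real v_def by (simp add: divide_inverse)
    have "norm (g t) * v \<le> ?R t"
    proof -
      consider "p t = \<infinity>" | "p t = 1" | r where "p t = ennreal r" "1 < r"
        using p1[of t] by (cases "p t") (auto simp flip: ennreal_1 simp: less_le)
      then show ?thesis
      proof cases
        case 1
        then have "norm (g t) * v \<le> M * (c * (1 + \<bar>t\<bar>) powr - a)"
          using elim v M(1) vp[of 1] by (intro mult_mono) auto
        also have "\<dots> \<le> (1 + M) * (c * (1 + \<bar>t\<bar>) powr - a)"
          using nonneg by (intro mult_right_mono) auto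
        finally show ?thesis using 1 by simp
      next
        case 2
        have "norm (g t) * v \<le> norm (g t)" using v by (simp add: mult_left_le)
        then show ?thesis using 2 M nonneg by (auto intro: add_increasing2)
      next
        case (3 r)
        have e: "enn2real (1 / p t) = 1 / r" using 3 by (simp add: divide_ennreal flip: ennreal_1)
        have "p t \<noteq> 1" using 3 by (simp flip: ennreal_1)
        then have "v powr (1 / (1 - 1 / r)) \<le> c * (1 + \<bar>t\<bar>) powr - a"
          using elim e vp by simp
        also have "\<dots> \<le> (1 + M) * (c * (1 + \<bar>t\<bar>) powr - a)"
          using nonneg M by (simp add: mult_le_cancel_right1)
        finally show ?thesis
          using young_crude[of "norm (g t)" v r] v 3 by simp
      qed
    qed
    then show ?case using lhs by simp
  qed
  then have "integrable lebesgue (\<lambda>t. g t / complex_of_real (1 + \<bar>t\<bar>))"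
    by (rule Bochner_Integration.integrable_bound[OF R, rotated])
      (intro borel_measurable_divide gm measurable_completion, measurable)
  then have "integrable lebesgue (\<lambda>t. complex_of_real l * (g t / complex_of_real (1 + \<bar>t\<bar>)))"
    by (rule integrable_mult_right)
  then show ?thesis using l by (simp add: tame_def g_def)
qed

section \<open>Stability of the variable Lebesgue spaces\<close>

lemma modular_cong_AE:
  assumes p: "p \<in> exponents"
    and m: "h \<in> borel_measurable lebesgue" "k \<in> borel_measurable lebesgue"
    and eq: "AE x in lebesgue. h x = k x"
  shows "modular p h = modular p k"
proof -
  have "esssup (restrict_space lebesgue {x. p x = \<infinity>}) (\<lambda>x. ennreal (norm (h x)))
      = esssup (restrict_space lebesgue {x. p x = \<infinity>}) (\<lambda>x. ennreal (norm (k x)))"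
  proof (rule esssup_AE_cong)
    show "AE x in restrict_space lebesgue {x. p x = \<infinity>}. ennreal (norm (h x)) = ennreal (norm (k x))"
      using eq exponent_infinity_set[OF p] by (subst AE_restrict_space_iff) auto
  qed (auto intro!: measurable_restrict_space1 measurable_compose[OF m(1)] measurable_compose[OF m(2)])
  moreover have "(\<integral>\<^sup>+x\<in>{x. p x \<noteq> \<infinity>}. ennreal (norm (h x) powr enn2real (p x)) \<partial>lebesgue)
      = (\<integral>\<^sup>+x\<in>{x. p x \<noteq> \<infinity>}. ennreal (norm (k x) powr enn2real (p x)) \<partial>lebesgue)"
    using eq by (intro nn_integral_cong_AE) auto
  ultimately show ?thesis by (simp add: modular_def)
qed

lemma Lp_norm_cong_AE:
  assumes p: "p \<in> exponents" and m: "h \<in> Lp p" "k \<in> Lp p"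
    and eq: "AE x in lebesgue. h x = k x"
  shows "Lp_norm p h = Lp_norm p k"
proof -
  have "modular p (\<lambda>x. h x / complex_of_real l) = modular p (\<lambda>x. k x / complex_of_real l)" for l
    using eq by (intro modular_cong_AE p borel_measurable_divide Lp_measurable[OF m(1)]
        Lp_measurable[OF m(2)] borel_measurable_const) auto
  then show ?thesis by (simp add: Lp_norm_def)
qed

text \<open>This quasi-triangle inequality replaces convexity: a power of a maximum is one of the two powers,
  whatever the exponent at that point.\<close>

lemma modular_le_add:
  assumes p: "p \<in> exponents"
    and f: "f \<in> borel_measurable lebesgue" and g: "g \<in> borel_measurable lebesgue"
    and k: "k \<in> borel_measurable lebesgue"
    and le: "\<And>x. norm (f x) \<le> max (norm (g x)) (norm (k x))"
  shows "modular p f \<le> modular p g + modular p k"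
proof -
  have [measurable]: "p \<in> borel_measurable lebesgue" using p by (simp add: exponents_def)
  note [measurable] = f g k
  have [measurable]: "{x. p x \<noteq> \<infinity>} \<in> sets lebesgue"
    using sets.compl_sets[OF exponent_infinity_set[OF p]] by (simp add: set_diff_eq)
  let ?R = "restrict_space lebesgue {x. p x = \<infinity>}"
  let ?E = "\<lambda>f. esssup ?R (\<lambda>x. ennreal (norm (f x :: complex)))"
  let ?m = "\<lambda>f x. ennreal (norm (f x :: complex) powr enn2real (p x)) * indicator {x. p x \<noteq> \<infinity>} x"
  have "(\<integral>\<^sup>+x. ?m f x \<partial>lebesgue) \<le> (\<integral>\<^sup>+x. ?m g x + ?m k x \<partial>lebesgue)"
  proof (rule nn_integral_mono)
    fix x
    have "norm (f x) powr enn2real (p x) \<le> max (norm (g x)) (norm (k x)) powr enn2real (p x)"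
      by (rule powr_mono2[OF _ _ le]) auto
    also have "\<dots> \<le> norm (g x) powr enn2real (p x) + norm (k x) powr enn2real (p x)"
      by (auto simp: max_def)
    finally show "?m f x \<le> ?m g x + ?m k x"
      by (auto simp: indicator_def simp flip: ennreal_plus)
  qed
  also have "\<dots> = (\<integral>\<^sup>+x. ?m g x \<partial>lebesgue) + (\<integral>\<^sup>+x. ?m k x \<partial>lebesgue)"
    by (rule nn_integral_add) measurable
  finally have 1: "(\<integral>\<^sup>+x. ?m f x \<partial>lebesgue) \<le> (\<integral>\<^sup>+x. ?m g x \<partial>lebesgue) + (\<integral>\<^sup>+x. ?m k x \<partial>lebesgue)" .
  have "AE x in ?R. ennreal (norm (g x)) \<le> ?E g" "AE x in ?R. ennreal (norm (k x)) \<le> ?E k"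
    by (rule esssup_AE)+
  then have "AE x in ?R. ennreal (norm (f x)) \<le> ?E g + ?E k"
  proof eventually_elim
    case (elim x)
    have "norm (f x) \<le> norm (g x) + norm (k x)"
      using le[of x] norm_ge_zero[of "g x"] norm_ge_zero[of "k x"] by linarith
    then have "ennreal (norm (f x)) \<le> ennreal (norm (g x)) + ennreal (norm (k x))"
      by (simp flip: ennreal_plus)
    also have "\<dots> \<le> ?E g + ?E k" using elim by (rule add_mono)
    finally show ?case .
  qed
  then have 2: "?E f \<le> ?E g + ?E k"
    by (intro esssup_I measurable_restrict_space1) measurable
  from add_mono[OF 1 2] show ?thesis
    by (simp add: modular_def add_ac)
qed

lemma Lp_linear_combination:
  assumes p: "p \<in> exponents" and h: "h \<in> Lp p" and k: "k \<in> Lp p"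
  shows "(\<lambda>x. c * h x + d * k x) \<in> Lp p"
proof -
  note [measurable] = Lp_measurable[OF h] Lp_measurable[OF k]
  obtain l1 where l1: "l1 > 0" "modular p (\<lambda>x. h x / complex_of_real l1) < \<infinity>"
    using h by (auto simp: Lp_def)
  obtain l2 where l2: "l2 > 0" "modular p (\<lambda>x. k x / complex_of_real l2) < \<infinity>"
    using k by (auto simp: Lp_def)
  \<comment> \<open>Dividing by \<open>l\<close> bounds the combination pointwise by the larger of \<open>h/l1\<close> and \<open>k/l2\<close>; the
      summand \<open>1\<close> keeps \<open>l\<close> positive when \<open>c = d = 0\<close>.\<close>
  define l where "l = norm c * l1 + norm d * l2 + 1"
  have l: "l > 0" using l1 l2 by (auto simp: l_def intro!: add_nonneg_pos)
  have "modular p (\<lambda>x. (c * h x + d * k x) / complex_of_real l)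
      \<le> modular p (\<lambda>x. h x / complex_of_real l1) + modular p (\<lambda>x. k x / complex_of_real l2)"
  proof (rule modular_le_add[OF p])
    fix x
    define m where "m = max (norm (h x) / l1) (norm (k x) / l2)"
    have "norm (h x) / l1 \<le> m" "norm (k x) / l2 \<le> m" by (auto simp: m_def)
    then have hk: "norm (h x) \<le> l1 * m" "norm (k x) \<le> l2 * m"
      using l1 l2 by (auto simp: field_simps)
    have m0: "m \<ge> 0" using l1 by (auto simp: m_def le_max_iff_disj)
    have "norm (c * h x + d * k x) \<le> norm c * norm (h x) + norm d * norm (k x)"
      by (metis norm_mult norm_triangle_ineq)
    also have "\<dots> \<le> norm c * (l1 * m) + norm d * (l2 * m)"
      using hk by (intro add_mono mult_left_mono) auto
    also have "\<dots> \<le> m * l" using m0 by (simp add: l_def algebra_simps)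
    finally have "norm (c * h x + d * k x) / l \<le> m" using l by (simp add: field_simps)
    then show "norm ((c * h x + d * k x) / complex_of_real l)
      \<le> max (norm (h x / complex_of_real l1)) (norm (k x / complex_of_real l2))"
      using l l1 l2 by (simp add: norm_divide m_def)
  qed measurable
  also have "\<dots> < \<infinity>" using l1 l2 by (simp add: ennreal_add_less_top)
  finally show ?thesis using l by (auto simp: Lp_def)
qed

lemma Lp_cong_norm:
  assumes "h \<in> Lp p" "k \<in> borel_measurable lebesgue" "\<And>x. norm (k x) = norm (h x)"
  shows "k \<in> Lp p"
  using assms by (auto simp: Lp_def modular_def norm_divide)

text \<open>Null sets are preserved by affine substitutions, read off from the substitution rule for the
  indicator function of a null set.\<close>

lemma AE_lebesgue_affine:
  fixes a b :: real
  assumes a: "a \<noteq> 0" and P: "AE x in lebesgue. P x"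
  shows "AE x in lebesgue. P (a * x + b)"
proof -
  obtain N where N: "N \<in> null_sets lebesgue" "\<And>x. x \<notin> N \<Longrightarrow> P x"
    using AE_E3[OF P] by auto
  have [measurable]: "N \<in> sets lebesgue" using N by auto
  have m: "(\<lambda>x. indicator N x :: ennreal) \<in> borel_measurable lebesgue" by measurable
  have m': "(\<lambda>x. indicator N (b + a * x) :: ennreal) \<in> borel_measurable lebesgue"
    using measurable_compose[OF lebesgue_affine_measurable[of "\<lambda>_. a" b] m] a by simp
  have "ennreal \<bar>a\<bar> * (\<integral>\<^sup>+x. indicator N (b + a * x) \<partial>lebesgue) = (\<integral>\<^sup>+x. indicator N x \<partial>lebesgue)"
    by (rule nn_integral_real_affine_lebesgue[OF m a, symmetric])
  also have "\<dots> = 0" using N by auto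
  finally have "(\<integral>\<^sup>+x. indicator N (b + a * x) \<partial>lebesgue) = 0" using a by simp
  then have "AE x in lebesgue. (indicator N (b + a * x) :: ennreal) = 0"
    using m' by (simp add: nn_integral_0_iff_AE)
  then show ?thesis
  proof eventually_elim
    case (elim x)
    then have "b + a * x \<notin> N" by (auto simp: indicator_def split: if_splits)
    then show ?case using N(2) by (auto simp: add.commute)
  qed
qed

lemma measurable_affine_lebesgue:
  fixes a b :: real
  assumes "a \<noteq> 0" "h \<in> borel_measurable lebesgue"
  shows "(\<lambda>x. h (a * x + b)) \<in> borel_measurable lebesgue"
  using measurable_compose[OF lebesgue_affine_measurable[of "\<lambda>_. a" b] assms(2)] assms(1)
  by (simp add: add.commute)

text \<open>Makes the log-Hoelder condition at infinity stable under affine substitutions: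
  \<open>e + \<bar>x\<bar>\<close> exceeds \<open>e + \<bar>a x + b\<bar>\<close> by at most a constant factor \<open>D\<close>, and \<open>ln (e + \<bar>y\<bar>) \<ge> 1\<close> absorbs the
  additive constant \<open>ln D\<close>.\<close>

lemma ln_affine_le:
  fixes a b :: real
  assumes "a \<noteq> 0"
  obtains K where "K > 0" "\<And>x. ln (exp 1 + \<bar>x\<bar>) \<le> K * ln (exp 1 + \<bar>a * x + b\<bar>)"
proof
  define D where "D = 1 + 1 / \<bar>a\<bar> + \<bar>b / a\<bar>"
  have D: "D \<ge> 1" by (simp add: D_def)
  show "1 + ln D > 0" using D by (simp add: add_pos_nonneg)
  fix x
  define y where "y = a * x + b"
  have e: "exp 1 \<ge> (1::real)" by simp
  have e': "exp 1 + \<bar>y\<bar> \<ge> 1" using e by linarith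
  have "x = y / a - b / a" using assms by (simp add: y_def field_simps)
  then have "\<bar>x\<bar> \<le> \<bar>y\<bar> / \<bar>a\<bar> + \<bar>b / a\<bar>" by (metis abs_divide abs_triangle_ineq4)
  also have "\<dots> \<le> (exp 1 + \<bar>y\<bar>) * (1 / \<bar>a\<bar>) + (exp 1 + \<bar>y\<bar>) * \<bar>b / a\<bar>"
    using e e' by (intro add_mono) (auto simp: divide_simps mult_le_cancel_right1)
  also have "\<dots> = (exp 1 + \<bar>y\<bar>) * D - (exp 1 + \<bar>y\<bar>)"
    by (simp add: D_def algebra_simps)
  finally have "exp 1 + \<bar>x\<bar> \<le> (exp 1 + \<bar>y\<bar>) * D" by simp
  then have "ln (exp 1 + \<bar>x\<bar>) \<le> ln ((exp 1 + \<bar>y\<bar>) * D)"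
    using e by (subst ln_le_cancel_iff) (auto intro!: mult_pos_pos add_pos_nonneg simp: D_def)
  also have "\<dots> = ln (exp 1 + \<bar>y\<bar>) + ln D"
    using D e' by (subst ln_mult) auto
  also have "\<dots> \<le> ln (exp 1 + \<bar>y\<bar>) + ln D * ln (exp 1 + \<bar>y\<bar>)"
  proof -
    have "ln (exp 1) \<le> ln (exp 1 + \<bar>y\<bar>)" by (subst ln_le_cancel_iff) (auto simp: add_pos_nonneg)
    then have "ln D * 1 \<le> ln D * ln (exp 1 + \<bar>y\<bar>)" using D by (intro mult_left_mono) auto
    then show ?thesis by simp
  qed
  finally show "ln (exp 1 + \<bar>x\<bar>) \<le> (1 + ln D) * ln (exp 1 + \<bar>a * x + b\<bar>)"
    by (simp add: y_def algebra_simps)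
qed

lemma admissible_affine:
  assumes a: "a \<noteq> 0" and p: "admissible p"
  shows "admissible (\<lambda>x. p (a * x + b))"
proof -
  have pm: "p \<in> borel_measurable lebesgue" and p1: "\<And>x. 1 \<le> p x"
    using p by (auto simp: admissible_def exponents_def)
  have pm': "(\<lambda>x. p (a * x + b)) \<in> borel_measurable lebesgue"
    by (rule measurable_affine_lebesgue[OF a pm])
  have "esssup lebesgue (\<lambda>x. p (a * x + b)) \<le> esssup lebesgue p"
    by (rule esssup_I[OF pm' AE_lebesgue_affine[OF a esssup_AE]])
  moreover have "log_holder_at_infinity_1 (\<lambda>x. p (a * x + b))" if lh: "log_holder_at_infinity_1 p"
  proof -
    obtain C where C: "C > 0" "AE x in lebesgue. \<bar>enn2real (1 / p x) - 1\<bar> \<le> C / ln (exp 1 + \<bar>x\<bar>)"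
      using lh by (auto simp: log_holder_at_infinity_1_def)
    obtain K where K: "K > 0" "\<And>x. ln (exp 1 + \<bar>x\<bar>) \<le> K * ln (exp 1 + \<bar>a * x + b\<bar>)"
      using ln_affine_le[OF a] by blast
    have "AE x in lebesgue. \<bar>enn2real (1 / p (a * x + b)) - 1\<bar> \<le> C * K / ln (exp 1 + \<bar>x\<bar>)"
      using AE_lebesgue_affine[OF a C(2), of b]
    proof eventually_elim
      case (elim x)
      have pos: "ln (exp 1 + \<bar>z\<bar>) > 0" for z :: real
      proof -
        have "ln (exp 1) \<le> ln (exp 1 + \<bar>z\<bar>)" by (subst ln_le_cancel_iff) (auto simp: add_pos_nonneg)
        then show ?thesis by simp
      qed
      have "C / ln (exp 1 + \<bar>a * x + b\<bar>) \<le> C * K / ln (exp 1 + \<bar>x\<bar>)"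
        using K(2)[of x] C(1) pos[of x] pos[of "a * x + b"]
        by (simp add: pos_divide_le_eq pos_le_divide_eq mult.assoc)
      then show ?case using elim by linarith
    qed
    then show ?thesis using C K by (auto simp: log_holder_at_infinity_1_def intro!: exI[of _ "C * K"])
  qed
  ultimately show ?thesis
    using p pm' p1 by (auto simp: admissible_def exponents_def)
qed

text \<open>The exponent moves along with the function, so the substituted function lies in a different space.
  This is why the transform of an affine substitution is taken in the union of all admissible spaces.\<close>

lemma Lp_affine:
  assumes a: "a \<noteq> 0" and p: "p \<in> exponents" and h: "h \<in> Lp p"
  shows "(\<lambda>x. h (a * x + b)) \<in> Lp (\<lambda>x. p (a * x + b))"
proof -
  have pm[measurable]: "p \<in> borel_measurable lebesgue" using p by (auto simp: exponents_def)
  note hm[measurable] = Lp_measurable[OF h]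
  have S[measurable]: "{x. p x \<noteq> \<infinity>} \<in> sets lebesgue"
    using sets.compl_sets[OF exponent_infinity_set[OF p]] by (simp add: set_diff_eq)
  obtain l where l: "l > 0" and fin: "modular p (\<lambda>x. h x / complex_of_real l) < \<infinity>"
    using h by (auto simp: Lp_def)
  define g where "g = (\<lambda>x. h x / complex_of_real l)"
  have gm[measurable]: "g \<in> borel_measurable lebesgue" unfolding g_def by measurable
  let ?m = "\<lambda>x. ennreal (norm (g x) powr enn2real (p x)) * indicator {x. p x \<noteq> \<infinity>} x"
  have "(\<integral>\<^sup>+x. ?m x \<partial>lebesgue) = ennreal \<bar>a\<bar> * (\<integral>\<^sup>+x. ?m (b + a * x) \<partial>lebesgue)"
    by (rule nn_integral_real_affine_lebesgue[OF _ a]) measurable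
  moreover have "(\<integral>\<^sup>+x. ?m x \<partial>lebesgue) < \<infinity>" using fin by (auto simp: modular_def g_def)
  ultimately have 1: "(\<integral>\<^sup>+x. ?m (b + a * x) \<partial>lebesgue) < \<infinity>"
    using a by (auto simp: ennreal_mult_less_top less_top ennreal_mult_eq_top_iff)
  let ?E = "esssup (restrict_space lebesgue {x. p x = \<infinity>}) (\<lambda>x. ennreal (norm (g x)))"
  let ?R = "restrict_space lebesgue {x. p (a * x + b) = \<infinity>}"
  have "AE x in restrict_space lebesgue {x. p x = \<infinity>}. ennreal (norm (g x)) \<le> ?E"
    by (rule esssup_AE)
  then have "AE x in lebesgue. p x = \<infinity> \<longrightarrow> ennreal (norm (g x)) \<le> ?E"
    using exponent_infinity_set[OF p] by (subst (asm) AE_restrict_space_iff) auto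
  then have AE': "AE x in lebesgue. p (a * x + b) = \<infinity> \<longrightarrow> ennreal (norm (g (a * x + b))) \<le> ?E"
    by (rule AE_lebesgue_affine[OF a])
  have p': "(\<lambda>x. p (a * x + b)) \<in> exponents"
    using p measurable_affine_lebesgue[OF a pm] by (auto simp: exponents_def)
  have "AE x in ?R. ennreal (norm (g (a * x + b))) \<le> ?E"
    using exponent_infinity_set[OF p'] AE' by (subst AE_restrict_space_iff) auto
  then have "esssup ?R (\<lambda>x. ennreal (norm (g (a * x + b)))) \<le> ?E"
    by (intro esssup_I measurable_restrict_space1
        measurable_compose[OF measurable_affine_lebesgue[OF a gm]]) auto
  also have "\<dots> < \<infinity>" using fin by (auto simp: modular_def g_def)
  finally have 2: "esssup ?R (\<lambda>x. ennreal (norm (g (a * x + b)))) < \<infinity>" .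
  have "modular (\<lambda>x. p (a * x + b)) (\<lambda>x. g (a * x + b)) < \<infinity>"
    using 1 2 by (simp add: modular_def add.commute indicator_def)
  then show ?thesis
    using l measurable_affine_lebesgue[OF a hm] by (auto simp: Lp_def g_def)
qed

lemma fourier_domainI: "admissible p \<Longrightarrow> h \<in> Lp p \<Longrightarrow> h \<in> fourier_domain"
  by (auto simp: fourier_domain_def)

lemma fourier_domain_affine:
  assumes "a \<noteq> 0" "h \<in> fourier_domain"
  shows "(\<lambda>x. h (a * x + b)) \<in> fourier_domain"
proof -
  obtain p where p: "admissible p" "h \<in> Lp p" using assms by (auto simp: fourier_domain_def)
  then show ?thesis
    using fourier_domainI[OF admissible_affine[of a p b] Lp_affine[of a p h b]] assms by (auto simp: admissible_def)
qed

lemma fourier_domain_tame: "h \<in> fourier_domain \<Longrightarrow> tame h"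
  by (auto simp: fourier_domain_def intro: Lp_imp_tame)

section \<open>The primitive of the Fourier transform\<close>

lemma u_fun_alt: "u_fun s t = (1 - iexp (- (s * t))) / (\<i> * complex_of_real t)"
  by (simp add: u_fun_def mult.assoc)

lemma u_fun_0 [simp]: "u_fun 0 t = 0" "u_fun s 0 = 0"
  by (simp_all add: u_fun_def)

text \<open>Combines \<open>\<bar>u\<^sub>s(t)\<bar> \<le> \<bar>s\<bar>\<close>, which controls \<open>t\<close> near \<open>0\<close>, with \<open>\<bar>t\<bar> \<bar>u\<^sub>s(t)\<bar> \<le> 2\<close>.\<close>

lemma u_fun_bound: "norm (u_fun s t) \<le> (2 + \<bar>s\<bar>) / (1 + \<bar>t\<bar>)"
proof (cases "t = 0")
  case False
  have n: "norm (u_fun s t) * \<bar>t\<bar> = norm (iexp (- (s * t)) - 1)"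
    using False by (simp add: u_fun_alt norm_divide norm_mult norm_minus_commute)
  have "norm (iexp (- (s * t)) - 1) \<le> \<bar>s\<bar> * \<bar>t\<bar>"
    using iexp_approx1[of "- (s * t)" 0] by (simp add: abs_mult)
  then have 1: "norm (u_fun s t) \<le> \<bar>s\<bar>" using n False by (metis mult_right_le_imp_le zero_less_abs_iff)
  have "norm (iexp (- (s * t)) - 1) \<le> 2"
    using norm_triangle_ineq4[of "iexp (- (s * t))" 1] by simp
  then have "norm (u_fun s t) * (1 + \<bar>t\<bar>) \<le> 2 + \<bar>s\<bar>" using 1 n by (simp add: algebra_simps)
  then show ?thesis by (simp add: pos_le_divide_eq add_pos_nonneg)
qed simp

lemma borel_measurable_u_fun [measurable]: "(\<lambda>x. u_fun (f x) (g x)) \<in> borel_measurable M"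
  if [measurable]: "f \<in> borel_measurable M" "g \<in> borel_measurable M"
  unfolding u_fun_def by measurable

lemma u_fun_vector_derivative:
  "t \<noteq> 0 \<Longrightarrow> ((\<lambda>s. u_fun s t) has_vector_derivative iexp (- (s * t))) (at s)"
proof -
  assume t: "t \<noteq> 0"
  have "((\<lambda>z. (1 - exp (- (\<i> * z * complex_of_real t))) / (\<i> * complex_of_real t))
      has_field_derivative exp (- (\<i> * complex_of_real s * complex_of_real t))) (at (complex_of_real s))"
    using t by (auto intro!: derivative_eq_intros simp: field_simps)
  from has_vector_derivative_real_field[OF this] show ?thesis
    by (simp add: u_fun_def mult.assoc)
qed

lemma continuous_u_fun: "continuous_on UNIV (\<lambda>s. u_fun s t)"
  unfolding u_fun_def by (cases "t = 0") (auto intro!: continuous_intros)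

lemma u_fun_times_bound:
  "norm (u_fun s t * h t) \<le> (2 + \<bar>s\<bar>) * (norm (h t) / (1 + \<bar>t\<bar>))"
  using mult_right_mono[OF u_fun_bound norm_ge_zero, of s t "h t"] by (simp add: norm_mult)

lemma measurable_u_fun_times:
  assumes "h \<in> borel_measurable lebesgue"
  shows "(\<lambda>t. u_fun s t * h t) \<in> borel_measurable lebesgue"
proof -
  have "(\<lambda>t. u_fun s t) \<in> borel_measurable lebesgue"
    by (rule measurable_completion) measurable
  then show ?thesis using assms by (rule borel_measurable_times)
qed

lemma Psi_integrand_integrable:
  assumes "tame h"
  shows "integrable lebesgue (\<lambda>t. u_fun s t * h t)"
proof (rule Bochner_Integration.integrable_bound)
  show "integrable lebesgue (\<lambda>t. (2 + \<bar>s\<bar>) * (norm (h t) / (1 + \<bar>t\<bar>)))"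
    using tame_norm_integrable[OF assms] by (rule integrable_mult_right)
  show "AE t in lebesgue. norm (u_fun s t * h t) \<le> norm ((2 + \<bar>s\<bar>) * (norm (h t) / (1 + \<bar>t\<bar>)))"
    using u_fun_times_bound[of s _ h] by (intro AE_I2) (auto intro: order_trans[OF _ abs_ge_self])
qed (rule measurable_u_fun_times[OF tame_measurable[OF assms]])

lemma Psi_eq_integral: "Psi h s = (LINT t|lebesgue. u_fun s t * h t)"
  by (simp add: Psi_def)

lemma Psi_bound:
  assumes "tame h"
  shows "norm (Psi h s) \<le> (2 + \<bar>s\<bar>) * tame_norm h"
proof -
  have "norm (Psi h s) \<le> (LINT t|lebesgue. norm (u_fun s t * h t))"
    unfolding Psi_eq_integral by (rule integral_norm_bound)
  also have "\<dots> \<le> (LINT t|lebesgue. (2 + \<bar>s\<bar>) * (norm (h t) / (1 + \<bar>t\<bar>)))"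
    by (intro integral_mono u_fun_times_bound integrable_norm Psi_integrand_integrable assms
        integrable_mult_right tame_norm_integrable)
  also have "\<dots> = (2 + \<bar>s\<bar>) * tame_norm h"
    by (simp only: integral_mult_right_zero tame_norm_def norm_tame_weight)
  finally show ?thesis .
qed

text \<open>Dominated convergence: along a convergent, hence bounded, sequence of parameters the kernels have
  a common majorant.\<close>

lemma continuous_on_Psi:
  assumes h: "tame h"
  shows "continuous_on UNIV (Psi h)"
proof -
  have "Psi h \<midarrow>s\<rightarrow> Psi h s" for s
  proof (subst tendsto_at_iff_sequentially, intro allI impI)
    fix X :: "nat \<Rightarrow> real"
    assume X: "X \<longlonglongrightarrow> s"
    then obtain B where B: "\<And>n. \<bar>X n\<bar> \<le> B"
      using convergent_imp_Bseq[of X] by (auto simp: convergent_def Bseq_def)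
    show "(Psi h \<circ> X) \<longlonglongrightarrow> Psi h s"
      unfolding comp_def Psi_eq_integral
    proof (rule integral_dominated_convergence)
      show "integrable lebesgue (\<lambda>t. (2 + B) * (norm (h t) / (1 + \<bar>t\<bar>)))"
        using tame_norm_integrable[OF h] by (rule integrable_mult_right)
      show "AE t in lebesgue. (\<lambda>n. u_fun (X n) t * h t) \<longlonglongrightarrow> u_fun s t * h t"
        by (intro AE_I2 tendsto_mult_right continuous_on_tendsto_compose[OF continuous_u_fun X]) auto
      show "AE t in lebesgue. norm (u_fun (X n) t * h t) \<le> (2 + B) * (norm (h t) / (1 + \<bar>t\<bar>))" for n
      proof (intro AE_I2)
        fix t
        have "(2 + \<bar>X n\<bar>) * (norm (h t) / (1 + \<bar>t\<bar>)) \<le> (2 + B) * (norm (h t) / (1 + \<bar>t\<bar>))"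
          using B[of n] by (intro mult_right_mono) auto
        then show "norm (u_fun (X n) t * h t) \<le> (2 + B) * (norm (h t) / (1 + \<bar>t\<bar>))"
          using u_fun_times_bound[of "X n" t h] by linarith
      qed
    qed (intro measurable_u_fun_times tame_measurable h)+
  qed
  then show ?thesis by (simp add: continuous_on_def)
qed

lemma Psi_cong_AE:
  assumes "h \<in> borel_measurable lebesgue" "k \<in> borel_measurable lebesgue"
    and "AE x in lebesgue. h x = k x"
  shows "Psi h = Psi k"
proof
  fix s
  have "(LINT t|lebesgue. u_fun s t * h t) = (LINT t|lebesgue. u_fun s t * k t)"
    using assms by (intro integral_cong_AE measurable_u_fun_times) auto
  then show "Psi h s = Psi k s" by (simp add: Psi_eq_integral)
qed

lemma Psi_linear_combination:
  assumes "tame h" "tame k"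
  shows "Psi (\<lambda>x. c * h x + d * k x) s = c * Psi h s + d * Psi k s"
proof -
  have "Psi (\<lambda>x. c * h x + d * k x) s
      = (LINT t|lebesgue. c * (u_fun s t * h t) + d * (u_fun s t * k t))"
    unfolding Psi_eq_integral by (rule Bochner_Integration.integral_cong) (auto simp: algebra_simps)
  also have "\<dots> = c * Psi h s + d * Psi k s"
    using Psi_integrand_integrable[OF assms(1), of s] Psi_integrand_integrable[OF assms(2), of s]
    by (simp add: Psi_eq_integral)
  finally show ?thesis .
qed

text \<open>Substituting \<open>y = a x\<close> uses the homogeneity \<open>u\<^bsub>s/a\<^esub>(a x) = u\<^sub>s(x)/a\<close>; the factor \<open>1/a\<close> meets the
  Jacobian \<open>\<bar>a\<bar>\<close>, which leaves the sign of \<open>a\<close>.\<close>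

lemma Psi_affine:
  fixes a b :: real
  assumes a: "a \<noteq> 0"
  shows "Psi (\<lambda>x. h (a * x + b)) s = complex_of_real (sgn a) * Psi (translate (- b) h) (s / a)"
proof -
  have u: "u_fun (s / a) (a * x) = u_fun s x / complex_of_real a" for x
    using a by (simp add: u_fun_alt)
  have "Psi (translate (- b) h) (s / a)
      = \<bar>a\<bar> *\<^sub>R (LINT x|lebesgue. u_fun (s / a) (0 + a * x) * h (0 + a * x + b))"
    unfolding Psi_eq_integral translate_def
    using lebesgue_integral_real_affine[OF a, of "\<lambda>y. u_fun (s / a) y * h (y + b)" 0] by simp
  also have "\<dots> = \<bar>a\<bar> *\<^sub>R (LINT x|lebesgue. inverse (complex_of_real a) * (u_fun s x * h (a * x + b)))"
    by (simp only: add_0_left u) (simp add: divide_inverse mult_ac)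
  also have "\<dots> = complex_of_real (\<bar>a\<bar> / a) * Psi (\<lambda>x. h (a * x + b)) s"
    by (simp only: integral_mult_right_zero Psi_eq_integral[symmetric])
      (simp add: scaleR_conv_of_real field_simps)
  finally have "complex_of_real (sgn a) * Psi (translate (- b) h) (s / a)
      = complex_of_real (sgn a * (\<bar>a\<bar> / a)) * Psi (\<lambda>x. h (a * x + b)) s" by simp
  also have "sgn a * (\<bar>a\<bar> / a) = 1" using a by (auto simp: sgn_if)
  finally show ?thesis by simp
qed

lemma Psi_reflect: "Psi (reflect h) = (\<lambda>s. - reflect (Psi h) s)"
  using Psi_affine[of "-1" h 0] by (auto simp: reflect_def translate_def)

lemma Psi_translate: "Psi (translate a h) s = conv h (reflect (u_fun s)) (- a)"
proof -
  have "Psi (translate a h) s = (LINT x|lebesgue. u_fun s (a + 1 * x) * h (a + 1 * x - a))"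
    unfolding Psi_eq_integral translate_def
    using lebesgue_integral_real_affine[of 1 "\<lambda>y. u_fun s y * h (y - a)" a] by simp
  then show ?thesis by (simp add: conv_def reflect_def mult.commute add.commute)
qed

text \<open>The constant \<open>Psi h (- a)\<close> normalises the translated primitive to vanish at \<open>0\<close>. It comes from
  \<open>u\<^sub>s(t) exp(i a t) = u\<^bsub>s-a\<^esub>(t) - u\<^bsub>-a\<^esub>(t)\<close>.\<close>

lemma Psi_modulate:
  assumes "tame h"
  shows "Psi (\<lambda>t. exp (\<i> * complex_of_real a * complex_of_real t) * h t) s
       = translate a (Psi h) s - Psi h (- a)"
proof -
  have u: "u_fun s t * exp (\<i> * complex_of_real a * complex_of_real t) = u_fun (s - a) t - u_fun (- a) t" for t
    by (cases "t = 0")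
      (simp_all add: u_fun_def field_simps exp_diff exp_minus exp_add[symmetric] right_diff_distrib left_diff_distrib)
  have "Psi (\<lambda>t. exp (\<i> * complex_of_real a * complex_of_real t) * h t) s
      = (LINT t|lebesgue. u_fun (s - a) t * h t - u_fun (- a) t * h t)"
    unfolding Psi_eq_integral mult.assoc[symmetric] u left_diff_distrib ..
  also have "\<dots> = Psi h (s - a) - Psi h (- a)"
    unfolding Psi_eq_integral by (intro Bochner_Integration.integral_diff Psi_integrand_integrable assms)
  finally show ?thesis by (simp add: translate_def)
qed

section \<open>Schwartz functions\<close>

lemma vderiv_eqI: "(\<And>x. (F has_vector_derivative G x) (at x)) \<Longrightarrow> vderiv F = G"
  by (auto simp: vderiv_def fun_eq_iff intro: vector_derivative_at)

lemma schwartz_vderiv: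
  assumes "\<phi> \<in> schwartz"
  shows "vderiv \<phi> \<in> schwartz"
proof -
  have eq: "(vderiv ^^ n) (vderiv \<phi>) = (vderiv ^^ Suc n) \<phi>" for n
    by (simp add: funpow_swap1)
  note \<phi> = assms[unfolded schwartz_def mem_Collect_eq]
  show ?thesis unfolding schwartz_def mem_Collect_eq eq
    by (intro conjI allI \<phi>[THEN conjunct1, rule_format] \<phi>[THEN conjunct2, rule_format])
qed

lemma schwartz_differentiable: "\<phi> \<in> schwartz \<Longrightarrow> (vderiv ^^ n) \<phi> differentiable (at x)"
  by (auto simp: schwartz_def)

lemma schwartz_has_vector_derivative:
  "\<phi> \<in> schwartz \<Longrightarrow> ((vderiv ^^ n) \<phi> has_vector_derivative (vderiv ^^ Suc n) \<phi> x) (at x)"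
  using schwartz_differentiable[of \<phi> n x] by (simp add: vderiv_def vector_derivative_works)

lemma schwartz_continuous: "\<phi> \<in> schwartz \<Longrightarrow> continuous_on UNIV \<phi>"
  using schwartz_differentiable[of \<phi> 0] by (auto intro!: continuous_at_imp_continuous_on differentiable_imp_continuous_within)

lemma schwartz_measurable: "\<phi> \<in> schwartz \<Longrightarrow> \<phi> \<in> borel_measurable borel"
  by (intro borel_measurable_continuous_onI schwartz_continuous)

lemma schwartz_seminorm_upper:
  "\<phi> \<in> schwartz \<Longrightarrow> \<bar>x\<bar> ^ k * norm ((vderiv ^^ n) \<phi> x) \<le> schwartz_seminorm k n \<phi>"
  unfolding schwartz_seminorm_def schwartz_def by (auto intro!: cSUP_upper)

lemma schwartz_seminorm_vderiv: "schwartz_seminorm k n (vderiv \<phi>) = schwartz_seminorm k (Suc n) \<phi>"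
  by (simp add: schwartz_seminorm_def funpow_swap1)

lemma vderiv_power_linear_combination:
  assumes "\<phi> \<in> schwartz" "\<psi> \<in> schwartz"
  shows "(vderiv ^^ n) (\<lambda>x. c * \<phi> x + d * \<psi> x) = (\<lambda>x. c * (vderiv ^^ n) \<phi> x + d * (vderiv ^^ n) \<psi> x)"
proof (induction n)
  case (Suc n)
  have "((\<lambda>x. c * (vderiv ^^ n) \<phi> x + d * (vderiv ^^ n) \<psi> x)
      has_vector_derivative c * (vderiv ^^ Suc n) \<phi> x + d * (vderiv ^^ Suc n) \<psi> x) (at x)" for x
    by (intro has_vector_derivative_add has_vector_derivative_mult_right schwartz_has_vector_derivative assms)
  from vderiv_eqI[OF this] show ?case by (simp add: Suc)
qed simp

lemma schwartz_linear_combination: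
  assumes \<phi>: "\<phi> \<in> schwartz" and \<psi>: "\<psi> \<in> schwartz"
  shows "(\<lambda>x. c * \<phi> x + d * \<psi> x) \<in> schwartz"
  unfolding schwartz_def mem_Collect_eq vderiv_power_linear_combination[OF assms]
proof (intro conjI allI)
  show "(\<lambda>x. c * (vderiv ^^ n) \<phi> x + d * (vderiv ^^ n) \<psi> x) differentiable at x" for n x
    by (intro derivative_intros differentiable_add differentiable_mult differentiable_const
        schwartz_differentiable assms)
  fix k n
  show "bdd_above (range (\<lambda>x. \<bar>x\<bar> ^ k * norm (c * (vderiv ^^ n) \<phi> x + d * (vderiv ^^ n) \<psi> x)))"
  proof (rule bdd_aboveI2)
    fix x
    have "\<bar>x\<bar> ^ k * norm (c * (vderiv ^^ n) \<phi> x + d * (vderiv ^^ n) \<psi> x)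
      \<le> \<bar>x\<bar> ^ k * (norm c * norm ((vderiv ^^ n) \<phi> x) + norm d * norm ((vderiv ^^ n) \<psi> x))"
      by (intro mult_left_mono) (metis norm_mult norm_triangle_ineq, simp)
    also have "\<dots> = norm c * (\<bar>x\<bar> ^ k * norm ((vderiv ^^ n) \<phi> x)) + norm d * (\<bar>x\<bar> ^ k * norm ((vderiv ^^ n) \<psi> x))"
      by (simp add: algebra_simps)
    also have "\<dots> \<le> norm c * schwartz_seminorm k n \<phi> + norm d * schwartz_seminorm k n \<psi>"
      by (intro add_mono mult_left_mono schwartz_seminorm_upper assms) auto
    finally show "\<bar>x\<bar> ^ k * norm (c * (vderiv ^^ n) \<phi> x + d * (vderiv ^^ n) \<psi> x)
      \<le> norm c * schwartz_seminorm k n \<phi> + norm d * schwartz_seminorm k n \<psi>" .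
  qed
qed

text \<open>Two seminorms control \<open>\<phi>\<close> against the linear growth of \<open>Psi h\<close> with an integrable majorant, because
  \<open>(1 + y)\<^sup>3 \<le> 4 (1 + y\<^sup>3)\<close>.\<close>

lemma schwartz_weight_bound:
  assumes "\<phi> \<in> schwartz"
  shows "(2 + \<bar>x\<bar>) * norm (\<phi> x)
    \<le> 8 * (schwartz_seminorm 0 0 \<phi> + schwartz_seminorm 3 0 \<phi>) * (1 + \<bar>x\<bar>) powr - 2"
proof -
  define y where "y = \<bar>x\<bar>"
  have y: "y \<ge> 0" by (simp add: y_def)
  have "0 \<le> (1 + y) * (y - 1)\<^sup>2" using y by simp
  then have "(1 + y) ^ 3 \<le> 4 * (1 + y ^ 3)"
    by (simp add: power2_eq_square power3_eq_cube algebra_simps)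
  have c: "(2 + y) * (1 + y)\<^sup>2 \<le> 8 * (1 + y ^ 3)"
  proof -
    have "(2 + y) * (1 + y)\<^sup>2 \<le> 2 * (1 + y) * (1 + y)\<^sup>2" using y by (intro mult_right_mono) auto
    also have "\<dots> = 2 * (1 + y) ^ 3" by (simp add: power2_eq_square power3_eq_cube)
    also note \<open>(1 + y) ^ 3 \<le> 4 * (1 + y ^ 3)\<close>
    finally show ?thesis by simp
  qed
  have "(2 + y) * norm (\<phi> x) * (1 + y)\<^sup>2 \<le> 8 * (1 + y ^ 3) * norm (\<phi> x)"
    using mult_right_mono[OF c norm_ge_zero, of "\<phi> x"] by (simp add: mult_ac)
  also have "\<dots> = 8 * (y ^ 0 * norm (\<phi> x) + y ^ 3 * norm (\<phi> x))" by (simp add: algebra_simps)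
  also have "\<dots> \<le> 8 * (schwartz_seminorm 0 0 \<phi> + schwartz_seminorm 3 0 \<phi>)"
    using schwartz_seminorm_upper[OF assms, of x 0 0] schwartz_seminorm_upper[OF assms, of x 3 0]
    by (simp add: y_def)
  finally have "(2 + y) * norm (\<phi> x) \<le> 8 * (schwartz_seminorm 0 0 \<phi> + schwartz_seminorm 3 0 \<phi>) / (1 + y)\<^sup>2"
    using y by (simp add: pos_le_divide_eq)
  moreover have "(1 + y) powr - 2 = 1 / (1 + y)\<^sup>2" using y by (simp add: powr_minus_divide powr_numeral)
  ultimately show ?thesis by (simp add: y_def)
qed

lemma schwartz_weight_integrable:
  assumes "\<phi> \<in> schwartz"
  shows "integrable lebesgue (\<lambda>x. (2 + \<bar>x\<bar>) * norm (\<phi> x))"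
proof (rule Bochner_Integration.integrable_bound)
  show "integrable lebesgue (\<lambda>x::real. 8 * (schwartz_seminorm 0 0 \<phi> + schwartz_seminorm 3 0 \<phi>) * (1 + \<bar>x\<bar>) powr - 2)"
    by (intro integrable_mult_right integrable_one_plus_abs_powr) simp
  note [measurable] = schwartz_measurable[OF assms]
  show "(\<lambda>x. (2 + \<bar>x\<bar>) * norm (\<phi> x)) \<in> borel_measurable lebesgue"
    by (rule measurable_completion) measurable
  show "AE x in lebesgue. norm ((2 + \<bar>x\<bar>) * norm (\<phi> x))
     \<le> norm (8 * (schwartz_seminorm 0 0 \<phi> + schwartz_seminorm 3 0 \<phi>) * (1 + \<bar>x\<bar>) powr - 2)"
  proof (intro AE_I2)
    fix x
    have "norm ((2 + \<bar>x\<bar>) * norm (\<phi> x)) = (2 + \<bar>x\<bar>) * norm (\<phi> x)" by simp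
    also have "\<dots> \<le> 8 * (schwartz_seminorm 0 0 \<phi> + schwartz_seminorm 3 0 \<phi>) * (1 + \<bar>x\<bar>) powr - 2"
      by (rule schwartz_weight_bound[OF assms])
    also have "\<dots> \<le> norm (8 * (schwartz_seminorm 0 0 \<phi> + schwartz_seminorm 3 0 \<phi>) * (1 + \<bar>x\<bar>) powr - 2)"
      unfolding real_norm_def by (rule abs_ge_self)
    finally show "norm ((2 + \<bar>x\<bar>) * norm (\<phi> x))
     \<le> norm (8 * (schwartz_seminorm 0 0 \<phi> + schwartz_seminorm 3 0 \<phi>) * (1 + \<bar>x\<bar>) powr - 2)" .
  qed
qed

lemma schwartz_integrable:
  assumes "\<phi> \<in> schwartz"
  shows "integrable lborel \<phi>"
proof -
  note [measurable] = schwartz_measurable[OF assms]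
  have "integrable lborel (\<lambda>x. (2 + \<bar>x\<bar>) * norm (\<phi> x))"
    using schwartz_weight_integrable[OF assms] by (subst (asm) integrable_completion) measurable
  then show ?thesis
    by (rule Bochner_Integration.integrable_bound)
       (auto simp: abs_mult mult_le_cancel_right1 intro!: AE_I2)
qed

lemma schwartz_tendsto_0:
  assumes "\<phi> \<in> schwartz"
  shows "(\<phi> \<longlongrightarrow> 0) at_top" "(\<phi> \<longlongrightarrow> 0) at_bot"
proof -
  define K where "K = schwartz_seminorm 1 0 \<phi>"
  have b: "norm (\<phi> x) \<le> K / \<bar>x\<bar>" if "x \<noteq> 0" for x
    using schwartz_seminorm_upper[OF assms, of x 1 0] that by (simp add: K_def field_simps)
  have "filterlim (abs :: real \<Rightarrow> real) at_top at_bot"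
    by (subst filterlim_at_bot_mirror) (simp add: filterlim_abs_real)
  then have t: "((\<lambda>x::real. K / \<bar>x\<bar>) \<longlongrightarrow> 0) at_bot"
    by (intro tendsto_divide_0[OF tendsto_const] filterlim_at_top_imp_at_infinity)
  have t': "((\<lambda>x::real. K / \<bar>x\<bar>) \<longlongrightarrow> 0) at_top"
    by (intro tendsto_divide_0[OF tendsto_const] filterlim_at_top_imp_at_infinity filterlim_abs_real)
  show "(\<phi> \<longlongrightarrow> 0) at_top"
    by (rule Lim_null_comparison[OF _ t'], rule eventually_mono[OF eventually_gt_at_top[of 0]], rule b) simp
  show "(\<phi> \<longlongrightarrow> 0) at_bot"
    by (rule Lim_null_comparison[OF _ t], rule eventually_mono[OF eventually_gt_at_bot[of 0]], rule b) simp
qed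

lemma integral_derivative_vanishing_at_infinity:
  fixes F f :: "real \<Rightarrow> complex"
  assumes "\<And>x. (F has_vector_derivative f x) (at x)" "continuous_on UNIV f" "integrable lborel f"
    and "(F \<longlongrightarrow> 0) at_top" "(F \<longlongrightarrow> 0) at_bot"
  shows "(LINT x|lborel. f x) = 0"
proof -
  have "(LBINT x=-\<infinity>..\<infinity>. f x) = 0 - 0"
  proof (rule interval_integral_FTC_integrable)
    show "((F \<circ> real_of_ereal) \<longlongrightarrow> 0) (at_right (- \<infinity>))" "((F \<circ> real_of_ereal) \<longlongrightarrow> 0) (at_left \<infinity>)"
      using assms by (simp_all add: ereal_tendsto_simps)
    show "set_integrable lborel (einterval (- \<infinity>) \<infinity>) f" using assms by (simp add: set_integrable_def einterval_def)
  qed (use assms in \<open>auto simp: continuous_on_eq_continuous_at\<close>)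
  then show ?thesis by (simp add: interval_lebesgue_integral_def einterval_def set_lebesgue_integral_def)
qed

lemma integral_vderiv_schwartz:
  assumes "\<phi> \<in> schwartz"
  shows "(LINT x|lebesgue. vderiv \<phi> x) = 0"
proof -
  have d: "vderiv \<phi> \<in> schwartz" using assms by (rule schwartz_vderiv)
  have "(LINT x|lborel. vderiv \<phi> x) = 0"
    using schwartz_has_vector_derivative[OF assms, of 0]
    by (intro integral_derivative_vanishing_at_infinity[of \<phi>] schwartz_continuous schwartz_integrable d
        schwartz_tendsto_0 assms) simp
  then show ?thesis using schwartz_measurable[OF d] by (simp add: integral_completion)
qed

subsection \<open>Gaussians\<close>

text \<open>From \<open>\<bar>x\<bar> \<le> exp \<bar>x\<bar>\<close> the power is at most \<open>exp (k \<bar>x\<bar>)\<close>; then complete the square.\<close>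

lemma abs_power_gaussian_bound:
  fixes x r :: real
  shows "\<bar>x\<bar> ^ k * exp (r * x - x\<^sup>2 / 2) \<le> exp ((real k + \<bar>r\<bar>)\<^sup>2 / 2)"
proof -
  have "\<bar>x\<bar> \<le> exp \<bar>x\<bar>" using exp_ge_add_one_self[of "\<bar>x\<bar>"] by linarith
  then have "\<bar>x\<bar> ^ k \<le> exp \<bar>x\<bar> ^ k" by (intro power_mono) auto
  also have "\<dots> = exp (real k * \<bar>x\<bar>)" by (simp add: exp_of_nat_mult)
  finally have "\<bar>x\<bar> ^ k * exp (r * x - x\<^sup>2 / 2) \<le> exp (real k * \<bar>x\<bar>) * exp (r * x - x\<^sup>2 / 2)"
    by (intro mult_right_mono) auto
  also have "\<dots> = exp (real k * \<bar>x\<bar> + r * x - x\<^sup>2 / 2)" by (simp add: exp_add[symmetric])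
  also have "\<dots> \<le> exp ((real k + \<bar>r\<bar>)\<^sup>2 / 2)"
  proof -
    have "r * x \<le> \<bar>r\<bar> * \<bar>x\<bar>" by (metis abs_ge_self abs_mult)
    moreover have "0 \<le> (\<bar>x\<bar> - (real k + \<bar>r\<bar>))\<^sup>2" by simp
    ultimately show ?thesis by (simp add: power2_eq_square algebra_simps)
  qed
  finally show ?thesis .
qed

text \<open>For real \<open>c\<close> this is a shifted Gaussian up to a constant factor, for imaginary \<open>c\<close> a modulated one.
  Complex \<open>c\<close> treats both families at once, and the Fourier transform exchanges them.\<close>

definition gaussian :: "complex \<Rightarrow> real \<Rightarrow> complex" where
  "gaussian c x = exp (c * complex_of_real x - (complex_of_real x)\<^sup>2 / 2)"

lemma norm_gaussian: "norm (gaussian c x) = exp (Re c * x - x\<^sup>2 / 2)"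
  by (simp add: gaussian_def norm_exp_eq_Re power2_eq_square)

lemma gaussian_poly_bounded:
  "\<exists>B. \<forall>x. \<bar>x\<bar> ^ k * norm (poly P (complex_of_real x) * gaussian c x) \<le> B"
proof (induction P arbitrary: k)
  case 0
  then show ?case by (auto intro: exI[of _ 0])
next
  case (pCons a P)
  obtain B where B: "\<And>x. \<bar>x\<bar> ^ Suc k * norm (poly P (complex_of_real x) * gaussian c x) \<le> B"
    using pCons.IH by blast
  have "\<bar>x\<bar> ^ k * norm (poly (pCons a P) (complex_of_real x) * gaussian c x)
      \<le> norm a * exp ((real k + \<bar>Re c\<bar>)\<^sup>2 / 2) + B" for x
  proof -
    have "norm (poly (pCons a P) (complex_of_real x) * gaussian c x)
      \<le> norm a * norm (gaussian c x) + \<bar>x\<bar> * norm (poly P (complex_of_real x) * gaussian c x)"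
      by (simp add: distrib_right order_trans[OF norm_triangle_ineq] norm_mult mult.assoc)
    then have "\<bar>x\<bar> ^ k * norm (poly (pCons a P) (complex_of_real x) * gaussian c x)
      \<le> \<bar>x\<bar> ^ k * (norm a * norm (gaussian c x) + \<bar>x\<bar> * norm (poly P (complex_of_real x) * gaussian c x))"
      by (intro mult_left_mono) auto
    also have "\<dots> = norm a * (\<bar>x\<bar> ^ k * exp (Re c * x - x\<^sup>2 / 2))
        + \<bar>x\<bar> ^ Suc k * norm (poly P (complex_of_real x) * gaussian c x)"
      by (simp add: norm_gaussian algebra_simps)
    also have "\<dots> \<le> norm a * exp ((real k + \<bar>Re c\<bar>)\<^sup>2 / 2) + B"
      by (intro add_mono B mult_left_mono abs_power_gaussian_bound) auto
    finally show ?thesis .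
  qed
  then show ?case by blast
qed

lemma gaussian_poly_derivative:
  "((\<lambda>x. poly P (complex_of_real x) * gaussian c x) has_vector_derivative
     poly (pderiv P + [:c, -1:] * P) (complex_of_real x) * gaussian c x) (at x)"
proof -
  have "((\<lambda>z. poly P z * exp (c * z - z\<^sup>2 / 2)) has_field_derivative
     poly (pderiv P + [:c, -1:] * P) (complex_of_real x) * gaussian c x) (at (complex_of_real x))"
    by (auto intro!: derivative_eq_intros simp: gaussian_def algebra_simps)
  from has_vector_derivative_real_field[OF this] show ?thesis by (simp add: gaussian_def)
qed

text \<open>Polynomial multiples of the Gaussian are closed under differentiation and are bounded together with
  their products with powers of \<open>x\<close>.\<close>

lemma gaussian_schwartz: "gaussian c \<in> schwartz"
proof -
  have "\<exists>P. (vderiv ^^ n) (gaussian c) = (\<lambda>x. poly P (complex_of_real x) * gaussian c x)" for n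
  proof (induction n)
    case 0
    show ?case by (rule exI[of _ 1]) simp
  next
    case (Suc n)
    then obtain P where "(vderiv ^^ n) (gaussian c) = (\<lambda>x. poly P (complex_of_real x) * gaussian c x)" by blast
    then have "(vderiv ^^ Suc n) (gaussian c)
        = (\<lambda>x. poly (pderiv P + [:c, -1:] * P) (complex_of_real x) * gaussian c x)"
      using vderiv_eqI[OF gaussian_poly_derivative, of P c] by simp
    then show ?case by blast
  qed
  then obtain P where P: "\<And>n. (vderiv ^^ n) (gaussian c) = (\<lambda>x. poly (P n) (complex_of_real x) * gaussian c x)"
    by metis
  show ?thesis unfolding schwartz_def mem_Collect_eq P
  proof (intro conjI allI)
    show "(\<lambda>x. poly (P n) (complex_of_real x) * gaussian c x) differentiable at x" for n x
      using gaussian_poly_derivative by (rule differentiableI_vector)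
    show "bdd_above (range (\<lambda>x. \<bar>x\<bar> ^ k * norm (poly (P n) (complex_of_real x) * gaussian c x)))" for k n
      using gaussian_poly_bounded[of k "P n" c] by (auto intro: bdd_aboveI2)
  qed
qed

section \<open>Pairing with Schwartz functions\<close>

lemma schwartz_weight_sup:
  assumes "\<phi> \<in> schwartz"
  shows "\<exists>B. \<forall>x. (1 + \<bar>x\<bar>) * norm (\<phi> x) \<le> B"
proof (intro exI allI)
  fix x
  have "(1 + \<bar>x\<bar>) * norm (\<phi> x) = \<bar>x\<bar> ^ 0 * norm (\<phi> x) + \<bar>x\<bar> ^ 1 * norm (\<phi> x)"
    by (simp add: algebra_simps)
  also have "\<dots> \<le> schwartz_seminorm 0 0 \<phi> + schwartz_seminorm 1 0 \<phi>"
    using schwartz_seminorm_upper[OF assms, of x 0 0] schwartz_seminorm_upper[OF assms, of x 1 0] by simp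
  finally show "(1 + \<bar>x\<bar>) * norm (\<phi> x) \<le> schwartz_seminorm 0 0 \<phi> + schwartz_seminorm 1 0 \<phi>" .
qed

lemma tame_schwartz_integrable:
  assumes h: "tame h" and \<phi>: "\<phi> \<in> schwartz"
  shows "integrable lebesgue (\<lambda>t. h t * \<phi> t)"
proof -
  obtain B where B: "\<And>x. (1 + \<bar>x\<bar>) * norm (\<phi> x) \<le> B" using schwartz_weight_sup[OF \<phi>] by blast
  show ?thesis
  proof (rule Bochner_Integration.integrable_bound)
    show "integrable lebesgue (\<lambda>t. B * (norm (h t) / (1 + \<bar>t\<bar>)))"
      by (intro integrable_mult_right tame_norm_integrable h)
    show "(\<lambda>t. h t * \<phi> t) \<in> borel_measurable lebesgue"
      by (intro borel_measurable_times tame_measurable[OF h] measurable_completion)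
        (simp add: schwartz_measurable[OF \<phi>])
    show "AE t in lebesgue. norm (h t * \<phi> t) \<le> norm (B * (norm (h t) / (1 + \<bar>t\<bar>)))"
    proof (rule AE_I2)
      fix t
      have "norm (h t * \<phi> t) = (1 + \<bar>t\<bar>) * norm (\<phi> t) * (norm (h t) / (1 + \<bar>t\<bar>))"
        by (simp add: norm_mult)
      also have "\<dots> \<le> B * (norm (h t) / (1 + \<bar>t\<bar>))" by (intro mult_right_mono B) auto
      also have "\<dots> \<le> norm (B * (norm (h t) / (1 + \<bar>t\<bar>)))" unfolding real_norm_def by (rule abs_ge_self)
      finally show "norm (h t * \<phi> t) \<le> norm (B * (norm (h t) / (1 + \<bar>t\<bar>)))" .
    qed
  qed
qed

lemma Psi_times_bound:
  "tame h \<Longrightarrow> norm (Psi h s * \<phi> s) \<le> tame_norm h * ((2 + \<bar>s\<bar>) * norm (\<phi> s))"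
  using mult_right_mono[OF Psi_bound[of h s] norm_ge_zero[of "\<phi> s"]] by (simp add: norm_mult mult_ac)

lemma Psi_measurable: "tame h \<Longrightarrow> Psi h \<in> borel_measurable borel"
  by (intro borel_measurable_continuous_onI continuous_on_Psi)

lemma Psi_schwartz_integrable:
  assumes h: "tame h" and \<phi>: "\<phi> \<in> schwartz"
  shows "integrable lebesgue (\<lambda>s. Psi h s * \<phi> s)"
proof (rule Bochner_Integration.integrable_bound)
  show "integrable lebesgue (\<lambda>s. tame_norm h * ((2 + \<bar>s\<bar>) * norm (\<phi> s)))"
    by (intro integrable_mult_right schwartz_weight_integrable \<phi>)
  note [measurable] = Psi_measurable[OF h] schwartz_measurable[OF \<phi>]
  show "(\<lambda>s. Psi h s * \<phi> s) \<in> borel_measurable lebesgue"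
    by (rule measurable_completion) measurable
  show "AE s in lebesgue. norm (Psi h s * \<phi> s) \<le> norm (tame_norm h * ((2 + \<bar>s\<bar>) * norm (\<phi> s)))"
    using Psi_times_bound[OF h, of _ \<phi>] by (intro AE_I2) (simp add: tame_norm_nonneg)
qed

text \<open>Continuity of the pairing in the Schwartz topology, in quantitative form.\<close>

lemma Psi_pairing_bound:
  assumes h: "tame h" and \<phi>: "\<phi> \<in> schwartz"
  shows "norm (LINT s|lebesgue. Psi h s * \<phi> s)
    \<le> tame_norm h * (8 * (schwartz_seminorm 0 0 \<phi> + schwartz_seminorm 3 0 \<phi>)
         * (LINT x|lebesgue. (1 + \<bar>x\<bar>) powr - 2))"
proof -
  have "norm (LINT s|lebesgue. Psi h s * \<phi> s) \<le> (LINT s|lebesgue. norm (Psi h s * \<phi> s))"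
    by (rule integral_norm_bound)
  also have "\<dots> \<le> (LINT s|lebesgue. tame_norm h *
      (8 * (schwartz_seminorm 0 0 \<phi> + schwartz_seminorm 3 0 \<phi>) * (1 + \<bar>s\<bar>) powr - 2))"
  proof (rule integral_mono)
    show "integrable lebesgue (\<lambda>s::real. tame_norm h *
      (8 * (schwartz_seminorm 0 0 \<phi> + schwartz_seminorm 3 0 \<phi>) * (1 + \<bar>s\<bar>) powr - 2))"
      by (intro integrable_mult_right integrable_one_plus_abs_powr) simp
    show "norm (Psi h s * \<phi> s) \<le> tame_norm h *
      (8 * (schwartz_seminorm 0 0 \<phi> + schwartz_seminorm 3 0 \<phi>) * (1 + \<bar>s\<bar>) powr - 2)" for s
      using Psi_times_bound[OF h, of s \<phi>]
        mult_left_mono[OF schwartz_weight_bound[OF \<phi>, of s] tame_norm_nonneg[of h]]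
      by linarith
  qed (intro integrable_norm Psi_schwartz_integrable h \<phi>)
  finally show ?thesis by (simp only: integral_mult_right_zero)
qed

lemma dist_deriv_regular:
  "dist_deriv (regular g) \<phi> = (if \<phi> \<in> schwartz then - (LINT s|lebesgue. g s * vderiv \<phi> s) else 0)"
  by (simp add: dist_deriv_def regular_def schwartz_vderiv)

lemma vderiv_linear_combination:
  "\<phi> \<in> schwartz \<Longrightarrow> \<psi> \<in> schwartz \<Longrightarrow> vderiv (\<lambda>x. c * \<phi> x + d * \<psi> x) = (\<lambda>x. c * vderiv \<phi> x + d * vderiv \<psi> x)"
  using vderiv_power_linear_combination[of \<phi> \<psi> 1 c d] by simp

text \<open>By linearity continuity at every \<open>\<phi>\<close> reduces to the bound on the pairing at the difference; the
  derivative shifts the seminorms involved to order \<open>1\<close>, so those of indices up to \<open>3\<close> suffice.\<close>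

lemma tempered_dist_deriv_Psi:
  assumes h: "tame h"
  shows "dist_deriv (regular (Psi h)) \<in> tempered_distributions"
proof -
  let ?T = "dist_deriv (regular (Psi h))"
  define J where "J = (LINT x|lebesgue. (1 + \<bar>x :: real\<bar>) powr - 2)"
  have J: "J \<ge> 0" by (simp add: J_def)
  define A where "A = tame_norm h * 16 * J"
  have A: "A \<ge> 0" using J tame_norm_nonneg[of h] by (simp add: A_def)
  have lin: "?T (\<lambda>x. c * \<phi> x + d * \<psi> x) = c * ?T \<phi> + d * ?T \<psi>"
    if \<phi>: "\<phi> \<in> schwartz" and \<psi>: "\<psi> \<in> schwartz" for \<phi> \<psi> c d
  proof -
    have "(LINT s|lebesgue. Psi h s * (c * vderiv \<phi> s + d * vderiv \<psi> s))
      = (LINT s|lebesgue. c * (Psi h s * vderiv \<phi> s) + d * (Psi h s * vderiv \<psi> s))"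
      by (rule Bochner_Integration.integral_cong) (auto simp: algebra_simps)
    also have "\<dots> = c * (LINT s|lebesgue. Psi h s * vderiv \<phi> s) + d * (LINT s|lebesgue. Psi h s * vderiv \<psi> s)"
      using Psi_schwartz_integrable[OF h schwartz_vderiv[OF \<phi>]] Psi_schwartz_integrable[OF h schwartz_vderiv[OF \<psi>]]
      by simp
    finally show ?thesis
      using \<phi> \<psi> by (simp add: dist_deriv_regular schwartz_linear_combination vderiv_linear_combination)
  qed
  have "\<exists>N. \<exists>\<delta>>0. \<forall>\<psi>\<in>schwartz. (\<forall>k\<le>N. \<forall>n\<le>N. schwartz_seminorm k n (\<lambda>x. \<psi> x - \<phi> x) < \<delta>)
          \<longrightarrow> norm (?T \<psi> - ?T \<phi>) < \<epsilon>" if \<phi>: "\<phi> \<in> schwartz" and \<epsilon>: "\<epsilon> > 0" for \<phi> and \<epsilon> :: real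
  proof (rule exI[of _ 3], rule exI[of _ "\<epsilon> / (A + 1)"], intro conjI ballI impI)
    show "\<epsilon> / (A + 1) > 0" using A \<epsilon> by simp
    fix \<psi> assume \<psi>: "\<psi> \<in> schwartz"
      and small: "\<forall>k\<le>3. \<forall>n\<le>3. schwartz_seminorm k n (\<lambda>x. \<psi> x - \<phi> x) < \<epsilon> / (A + 1)"
    define \<eta> where "\<eta> = (\<lambda>x. \<psi> x - \<phi> x)"
    have \<eta>: "\<eta> \<in> schwartz" using schwartz_linear_combination[OF \<psi> \<phi>, of 1 "-1"] by (simp add: \<eta>_def)
    have "?T \<psi> - ?T \<phi> = ?T \<eta>" using lin[OF \<psi> \<phi>, of 1 "-1"] by (simp add: \<eta>_def)
    also have "norm \<dots> = norm (LINT s|lebesgue. Psi h s * vderiv \<eta> s)"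
      using \<eta> by (simp add: dist_deriv_regular)
    also have "\<dots> \<le> tame_norm h * (8 * (schwartz_seminorm 0 1 \<eta> + schwartz_seminorm 3 1 \<eta>) * J)"
      using Psi_pairing_bound[OF h schwartz_vderiv[OF \<eta>]] by (simp add: schwartz_seminorm_vderiv J_def)
    also have "\<dots> \<le> tame_norm h * (8 * (\<epsilon> / (A + 1) + \<epsilon> / (A + 1)) * J)"
      using small[rule_format, of 0 1] small[rule_format, of 3 1] J
      by (intro mult_left_mono mult_right_mono tame_norm_nonneg add_mono) (auto simp: \<eta>_def)
    also have "\<dots> = A * \<epsilon> / (A + 1)" by (simp add: A_def)
    also have "\<dots> < \<epsilon>" using A \<epsilon> by (simp add: pos_divide_less_eq algebra_simps)
    finally show "norm (?T \<psi> - ?T \<phi>) < \<epsilon>" .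
  qed
  then show ?thesis using lin by (auto simp: tempered_distributions_def dist_deriv_regular)
qed

section \<open>Injectivity of the Fourier transform\<close>

text \<open>The positive and negative parts of \<open>r\<close> have the same Fourier transform, in particular, at frequency
  \<open>0\<close>, the same mass \<open>m\<close>. If \<open>m = 0\<close>, both vanish almost everywhere; otherwise, divided by \<open>m\<close>, they are densities of two probability measures with equal
  characteristic functions, which coincide by Levy's theorem.\<close>

lemma AE_eq_0_if_fourier_integral_eq_0_real:
  fixes r :: "real \<Rightarrow> real"
  assumes r: "integrable lborel r"
    and zero: "\<And>u. (CLINT x|lborel. iexp (u * x) * complex_of_real (r x)) = 0"
  shows "AE x in lborel. r x = 0"
proof -
  note [measurable] = borel_measurable_integrable[OF r]
  define P where "P = (\<lambda>x. max 0 (r x))"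
  define N where "N = (\<lambda>x. max 0 (- r x))"
  have P: "integrable lborel P" "\<And>x. 0 \<le> P x" and N: "integrable lborel N" "\<And>x. 0 \<le> N x"
    using r by (auto simp: P_def N_def)
  have rPN: "r x = P x - N x" for x by (simp add: P_def N_def max_def)
  have int: "complex_integrable lborel (\<lambda>x. Q x *\<^sub>R iexp (u * x))" if Q: "integrable lborel Q" for u Q
  proof (rule Bochner_Integration.integrable_bound[OF Q])
    note [measurable] = borel_measurable_integrable[OF Q]
    show "(\<lambda>x. Q x *\<^sub>R iexp (u * x)) \<in> borel_measurable lborel" by measurable
  qed auto
  have eq: "(CLINT x|lborel. P x *\<^sub>R iexp (u * x)) = (CLINT x|lborel. N x *\<^sub>R iexp (u * x))" for u
  proof -
    have "(CLINT x|lborel. P x *\<^sub>R iexp (u * x)) - (CLINT x|lborel. N x *\<^sub>R iexp (u * x))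
        = (CLINT x|lborel. P x *\<^sub>R iexp (u * x) - N x *\<^sub>R iexp (u * x))"
      using int[OF P(1)] int[OF N(1)] by (rule Bochner_Integration.integral_diff[symmetric])
    also have "\<dots> = (CLINT x|lborel. iexp (u * x) * complex_of_real (r x))"
      by (rule Bochner_Integration.integral_cong) (auto simp: rPN scaleR_conv_of_real algebra_simps)
    finally show ?thesis using zero by simp
  qed
  define m where "m = (LINT x|lborel. P x)"
  have "complex_of_real m = complex_of_real (LINT x|lborel. N x)"
    using eq[of 0] by (simp add: m_def scaleR_conv_of_real)
  then have mN: "m = (LINT x|lborel. N x)" by (simp only: of_real_eq_iff)
  have m0: "m \<ge> 0" using P by (simp add: m_def)
  have "AE x in lborel. P x = N x"
  proof (cases "m = 0")
    case True
    then have "AE x in lborel. P x = 0" "AE x in lborel. N x = 0"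
      using integral_nonneg_eq_0_iff_AE[OF P(1)] integral_nonneg_eq_0_iff_AE[OF N(1)] P N mN
      by (auto simp: m_def)
    then show ?thesis by eventually_elim simp
  next
    case False
    then have m: "m > 0" using m0 by simp
    define D where "D = (\<lambda>(Q :: real \<Rightarrow> real) x. ennreal (Q x / m))"
    have rd: "real_distribution (density lborel (D Q))"
      if Q: "integrable lborel Q" "\<And>x. 0 \<le> Q x" "(LINT x|lborel. Q x) = m" for Q
    proof -
      note [measurable] = borel_measurable_integrable[OF Q(1)]
      have "emeasure (density lborel (D Q)) UNIV = (\<integral>\<^sup>+x. ennreal (Q x / m) \<partial>lborel)"
        by (simp add: emeasure_density D_def)
      also have "\<dots> = ennreal (LINT x|lborel. Q x / m)"
        using Q m by (intro nn_integral_eq_integral) auto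
      also have "\<dots> = 1" using Q m by simp
      finally show ?thesis
        by (intro real_distribution.intro real_distribution_axioms.intro prob_spaceI) simp_all
    qed
    have ch: "char (density lborel (D Q)) u = (CLINT x|lborel. Q x *\<^sub>R iexp (u * x)) / m"
      if Q: "integrable lborel Q" "\<And>x. 0 \<le> Q x" for Q u
    proof -
      note [measurable] = borel_measurable_integrable[OF Q(1)]
      have "char (density lborel (D Q)) u = (CLINT x|lborel. (Q x / m) *\<^sub>R iexp (u * x))"
        unfolding char_def D_def using Q m by (subst integral_density) auto
      also have "\<dots> = (CLINT x|lborel. (Q x *\<^sub>R iexp (u * x)) / m)"
        by (rule Bochner_Integration.integral_cong) (auto simp: scaleR_conv_of_real)
      finally show ?thesis by simp
    qed
    have "density lborel (D P) = density lborel (D N)"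
    proof (rule Levy_uniqueness)
      show "real_distribution (density lborel (D P))" using P by (intro rd) (auto simp: m_def)
      show "real_distribution (density lborel (D N))" using N mN by (intro rd) auto
      show "char (density lborel (D P)) = char (density lborel (D N))"
        using ch[OF P] ch[OF N] eq by (simp add: fun_eq_iff)
    qed
    moreover have "D P \<in> borel_measurable lborel" "D N \<in> borel_measurable lborel"
      by (auto simp: D_def P_def N_def)
    ultimately have "AE x in lborel. D P x = D N x"
      by (simp add: sigma_finite_measure.density_unique_iff[OF sigma_finite_lborel])
    then show ?thesis
      by eventually_elim (use P N m in \<open>auto simp: D_def\<close>)
  qed
  then show ?thesis by eventually_elim (simp add: rPN)
qed

text \<open>The complex conjugate of \<open>G\<close> also has vanishing transform (at the opposite frequency), hence so do the
  real and the imaginary part.\<close>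

lemma AE_eq_0_if_fourier_integral_eq_0:
  fixes G :: "real \<Rightarrow> complex"
  assumes G: "integrable lborel G"
    and zero: "\<And>u. (CLINT x|lborel. iexp (u * x) * G x) = 0"
  shows "AE x in lborel. G x = 0"
proof -
  note [measurable] = borel_measurable_integrable[OF G]
  have int: "integrable lborel (\<lambda>x. iexp (u * x) * H x)" if H: "integrable lborel H" for u and H :: "real \<Rightarrow> complex"
  proof (rule Bochner_Integration.integrable_bound[OF H])
    note [measurable] = borel_measurable_integrable[OF H]
    show "(\<lambda>x. iexp (u * x) * H x) \<in> borel_measurable lborel" by measurable
  qed (auto simp: norm_mult)
  have Gc: "integrable lborel (\<lambda>x. cnj (G x))" using G by simp
  have zc: "(CLINT x|lborel. iexp (u * x) * cnj (G x)) = 0" for u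
  proof -
    have "(CLINT x|lborel. iexp (u * x) * cnj (G x)) = cnj (CLINT x|lborel. iexp (- u * x) * G x)"
      unfolding Bochner_Integration.integral_cnj[symmetric] by (rule Bochner_Integration.integral_cong) (auto simp: exp_cnj)
    then show ?thesis using zero[of "- u"] by simp
  qed
  have comb: "(CLINT x|lborel. iexp (u * x) * (c * (G x + d * cnj (G x)))) = 0" for u c d
  proof -
    have "(CLINT x|lborel. iexp (u * x) * (c * (G x + d * cnj (G x))))
       = (CLINT x|lborel. c * (iexp (u * x) * G x) + c * d * (iexp (u * x) * cnj (G x)))"
      by (rule Bochner_Integration.integral_cong) (auto simp: algebra_simps)
    also have "\<dots> = c * (CLINT x|lborel. iexp (u * x) * G x) + c * d * (CLINT x|lborel. iexp (u * x) * cnj (G x))"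
      using int[OF G, of u] int[OF Gc, of u] by simp
    finally show ?thesis using zero zc by simp
  qed
  have Re: "complex_of_real (Re z) = 1 / 2 * (z + 1 * cnj z)" for z
    by (simp add: complex_eq_iff)
  have Im: "complex_of_real (Im z) = - (\<i> / 2) * (z + (- 1) * cnj z)" for z
    by (simp add: complex_eq_iff)
  have "AE x in lborel. Re (G x) = 0"
    using G by (intro AE_eq_0_if_fourier_integral_eq_0_real) (simp, simp only: Re comb)
  moreover have "AE x in lborel. Im (G x) = 0"
    using G by (intro AE_eq_0_if_fourier_integral_eq_0_real) (simp, simp only: Im comb)
  ultimately show ?thesis by eventually_elim (simp add: complex_eq_iff)
qed

text \<open>The pairings are the values of the Fourier transform of \<open>k(t) exp(-t\<^sup>2/2)\<close>, where the Gaussian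
  factor turns the tame function into an integrable one.\<close>

lemma tame_eq_0_if_gaussian_pairings_eq_0:
  assumes k: "tame k" and zero: "\<And>u. (LINT t|lebesgue. k t * gaussian (\<i> * complex_of_real u) t) = 0"
  shows "AE t in lebesgue. k t = 0"
proof -
  obtain k' where k': "k' \<in> borel_measurable borel" "tame k'" "AE x in lebesgue. k x = k' x"
    using tame_borel_representative[OF k] .
  note [measurable] = k'(1) schwartz_measurable[OF gaussian_schwartz]
  define G where "G = (\<lambda>t. k' t * gaussian 0 t)"
  have G: "integrable lborel G"
    using tame_schwartz_integrable[OF k'(2) gaussian_schwartz[of 0]]
    by (subst (asm) integrable_completion) (auto simp: G_def)
  have "(CLINT x|lborel. iexp (u * x) * G x) = 0" for u
  proof -
    have g: "iexp (u * x) * G x = k' x * gaussian (\<i> * complex_of_real u) x" for x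
      by (simp add: G_def gaussian_def mult.left_commute mult.assoc flip: exp_add)
    have "(CLINT x|lborel. iexp (u * x) * G x) = (LINT x|lebesgue. k' x * gaussian (\<i> * complex_of_real u) x)"
      unfolding g by (subst integral_completion) auto
    also have "\<dots> = (LINT x|lebesgue. k x * gaussian (\<i> * complex_of_real u) x)"
      using k'(3) borel_measurable_integrable[OF tame_schwartz_integrable[OF k'(2) gaussian_schwartz]]
        borel_measurable_integrable[OF tame_schwartz_integrable[OF k gaussian_schwartz]]
      by (intro integral_cong_AE) auto
    finally show ?thesis using zero by simp
  qed
  then have "AE x in lborel. G x = 0" by (rule AE_eq_0_if_fourier_integral_eq_0[OF G])
  then have "AE x in lebesgue. G x = 0" by (rule AE_completion)
  with k'(3) show ?thesis by eventually_elim (simp add: G_def gaussian_def)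
qed

lemma regular_inject:
  assumes h: "tame h" and k: "tame k" and eq: "regular h = regular k"
  shows "AE x in lebesgue. h x = k x"
proof -
  have d: "tame (\<lambda>x. h x - k x)" using h k by (rule tame_diff)
  have "AE x in lebesgue. h x - k x = 0"
  proof (rule tame_eq_0_if_gaussian_pairings_eq_0[OF d])
    fix u
    let ?g = "gaussian (\<i> * complex_of_real u)"
    have "(LINT t|lebesgue. (h t - k t) * ?g t) = (LINT t|lebesgue. h t * ?g t) - (LINT t|lebesgue. k t * ?g t)"
      using tame_schwartz_integrable[OF h gaussian_schwartz] tame_schwartz_integrable[OF k gaussian_schwartz]
      by (simp add: left_diff_distrib)
    also have "\<dots> = regular h ?g - regular k ?g" by (simp add: regular_def gaussian_schwartz)
    finally show "(LINT t|lebesgue. (h t - k t) * ?g t) = 0" using eq by simp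
  qed
  then show ?thesis by simp
qed

text \<open>Substituting \<open>s = u + r\<close> reduces the integral to the characteristic function of the standard normal
  distribution.\<close>

lemma fourier_integral_gaussian:
  "(CLINT s|lborel. iexp (- (s * t)) * gaussian (complex_of_real u) s)
    = complex_of_real (exp (u\<^sup>2 / 2) * sqrt (2 * pi)) * gaussian (\<i> * complex_of_real (- u)) t"
proof -
  have c: "(CLINT r|lborel. std_normal_density r *\<^sub>R iexp (- t * r)) = complex_of_real (exp (- (t\<^sup>2) / 2))"
  proof -
    have "char std_normal_distribution (- t) = (CLINT r|lborel. std_normal_density r *\<^sub>R iexp (- t * r))"
      unfolding char_def by (subst integral_density) auto
    then show ?thesis by (simp add: char_std_normal_distribution)
  qed
  have g: "iexp (- ((u + r) * t)) * gaussian (complex_of_real u) (u + r)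
      = complex_of_real (exp (u\<^sup>2 / 2) * sqrt (2 * pi)) * iexp (- (u * t)) * (std_normal_density r *\<^sub>R iexp (- t * r))" for r
  proof -
    have "gaussian (complex_of_real u) (u + r) = complex_of_real (exp (u * (u + r) - (u + r)\<^sup>2 / 2))"
      by (simp add: gaussian_def exp_of_real[symmetric])
    also have "u * (u + r) - (u + r)\<^sup>2 / 2 = u\<^sup>2 / 2 + - r\<^sup>2 / 2"
      by (simp add: power2_eq_square field_simps)
    also have "exp (u\<^sup>2 / 2 + - r\<^sup>2 / 2) = exp (u\<^sup>2 / 2) * sqrt (2 * pi) * std_normal_density r"
      by (simp add: std_normal_density_def flip: exp_add)
    finally have 1: "gaussian (complex_of_real u) (u + r)
      = complex_of_real (exp (u\<^sup>2 / 2) * sqrt (2 * pi) * std_normal_density r)" .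
    have 2: "iexp (- ((u + r) * t)) = iexp (- (u * t)) * iexp (- t * r)"
      by (simp add: exp_add[symmetric] algebra_simps)
    show ?thesis unfolding 1 2 by (simp add: scaleR_conv_of_real mult_ac)
  qed
  have "(CLINT s|lborel. iexp (- (s * t)) * gaussian (complex_of_real u) s)
      = (CLINT r|lborel. iexp (- ((u + r) * t)) * gaussian (complex_of_real u) (u + r))"
    using lborel_integral_real_affine[of 1 "\<lambda>s. iexp (- (s * t)) * gaussian (complex_of_real u) s" u] by simp
  also have "\<dots> = complex_of_real (exp (u\<^sup>2 / 2) * sqrt (2 * pi)) * iexp (- (u * t)) * complex_of_real (exp (- (t\<^sup>2) / 2))"
    unfolding g integral_mult_right_zero c ..
  also have "\<dots> = complex_of_real (exp (u\<^sup>2 / 2) * sqrt (2 * pi)) * (iexp (- (u * t)) * complex_of_real (exp (- (t\<^sup>2) / 2)))"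
    by (rule mult.assoc)
  also have "iexp (- (u * t)) * complex_of_real (exp (- (t\<^sup>2) / 2)) = gaussian (\<i> * complex_of_real (- u)) t"
    by (simp add: gaussian_def exp_of_real[symmetric] exp_add[symmetric] mult_ac)
  finally show ?thesis .
qed

text \<open>Integration by parts. The restriction \<open>t \<noteq> 0\<close> matters: the kernel takes the default value \<open>0\<close> at
  \<open>t = 0\<close>, whereas the Fourier integral of \<open>\<phi>\<close> need not vanish there.\<close>

lemma integral_u_fun_vderiv:
  assumes \<phi>: "\<phi> \<in> schwartz" and t: "t \<noteq> 0"
  shows "(LINT s|lborel. u_fun s t * vderiv \<phi> s) = - (LINT s|lborel. iexp (- (s * t)) * \<phi> s)"
proof -
  have d: "vderiv \<phi> \<in> schwartz" using \<phi> by (rule schwartz_vderiv)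
  note [measurable] = schwartz_measurable[OF \<phi>] schwartz_measurable[OF d]
  have ub: "norm (u_fun s t) \<le> 2 / \<bar>t\<bar>" for s
    using t norm_triangle_ineq4[of 1 "iexp (- (s * t))"]
    by (simp add: u_fun_alt norm_divide norm_mult divide_right_mono)
  have i1: "integrable lborel (\<lambda>s. iexp (- (s * t)) * \<phi> s)"
    by (rule Bochner_Integration.integrable_bound[OF schwartz_integrable[OF \<phi>]]) (auto simp: norm_mult)
  have i2: "integrable lborel (\<lambda>s. u_fun s t * vderiv \<phi> s)"
  proof (rule Bochner_Integration.integrable_bound)
    show "integrable lborel (\<lambda>s. complex_of_real (2 / \<bar>t\<bar>) * vderiv \<phi> s)"
      by (intro integrable_mult_right schwartz_integrable d)
    show "AE s in lborel. norm (u_fun s t * vderiv \<phi> s) \<le> norm (complex_of_real (2 / \<bar>t\<bar>) * vderiv \<phi> s)"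
      unfolding norm_mult norm_of_real using ub by (intro AE_I2 mult_right_mono) auto
  qed measurable
  have lim: "((\<lambda>s. u_fun s t * \<phi> s) \<longlongrightarrow> 0) F" if "(\<phi> \<longlongrightarrow> 0) F" for F
  proof (rule Lim_null_comparison)
    show "\<forall>\<^sub>F s in F. norm (u_fun s t * \<phi> s) \<le> 2 / \<bar>t\<bar> * norm (\<phi> s)"
      unfolding norm_mult by (intro always_eventually allI mult_right_mono ub) auto
    show "((\<lambda>s. 2 / \<bar>t\<bar> * norm (\<phi> s)) \<longlongrightarrow> 0) F"
      by (intro tendsto_mult_right_zero tendsto_norm_zero that)
  qed
  have "(LINT s|lborel. iexp (- (s * t)) * \<phi> s + u_fun s t * vderiv \<phi> s) = 0"
  proof (rule integral_derivative_vanishing_at_infinity)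
    show "((\<lambda>s. u_fun s t * \<phi> s) has_vector_derivative iexp (- (s * t)) * \<phi> s + u_fun s t * vderiv \<phi> s) (at s)" for s
      using has_vector_derivative_mult[OF u_fun_vector_derivative[OF t, of s]
          schwartz_has_vector_derivative[OF \<phi>, of 0 s, simplified]] by (simp add: add.commute)
    show "continuous_on UNIV (\<lambda>s. iexp (- (s * t)) * \<phi> s + u_fun s t * vderiv \<phi> s)"
      by (intro continuous_intros continuous_u_fun schwartz_continuous \<phi> d)
  qed (use i1 i2 lim schwartz_tendsto_0[OF \<phi>] in auto)
  then show ?thesis using i1 i2 by (simp add: add_eq_0_iff)
qed

text \<open>The distributional Fourier transform acts by transposition, as the classical one does. The
  integrand \<open>u\<^sub>s(t) h(t) \<phi>'(s)\<close> of the double integral is dominated by the product of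
  \<open>(2 + \<bar>s\<bar>) \<bar>\<phi>'(s)\<bar>\<close> and \<open>\<bar>h(t)\<bar>/(1 + \<bar>t\<bar>)\<close>, so the order of integration can be exchanged.\<close>

lemma dist_deriv_Psi_eq_integral_fourier:
  assumes h: "tame h" and \<phi>: "\<phi> \<in> schwartz"
  shows "dist_deriv (regular (Psi h)) \<phi> = (LINT t|lebesgue. h t * (LINT s|lborel. iexp (- (s * t)) * \<phi> s))"
proof -
  have d: "vderiv \<phi> \<in> schwartz" using \<phi> by (rule schwartz_vderiv)
  obtain h' where h': "h' \<in> borel_measurable borel" "tame h'" "AE x in lebesgue. h x = h' x"
    using tame_borel_representative[OF h] .
  note [measurable] = h'(1) schwartz_measurable[OF \<phi>] schwartz_measurable[OF d] Psi_measurable[OF h'(2)]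
  define w where "w = (\<lambda>t. norm (h' t) / (1 + \<bar>t\<bar>))"
  define b where "b = (\<lambda>s. (2 + \<bar>s\<bar>) * norm (vderiv \<phi> s))"
  have w0: "0 \<le> w t" and b0: "0 \<le> b t" for t by (auto simp: w_def b_def)
  have [measurable]: "w \<in> borel_measurable borel" "b \<in> borel_measurable borel"
    unfolding w_def b_def by measurable
  have w: "integrable lborel w"
    using tame_norm_integrable[OF h'(2)] by (subst (asm) integrable_completion) (auto simp: w_def)
  have b: "integrable lborel b"
    using schwartz_weight_integrable[OF d] by (subst (asm) integrable_completion) (auto simp: b_def)
  have bw: "integrable (lborel \<Otimes>\<^sub>M lborel) (\<lambda>(s, t). b s * w t)"
    by (rule lborel_pair.Fubini_integrable) (use b w w0 b0 in \<open>auto simp: abs_mult\<close>)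
  have F: "integrable (lborel \<Otimes>\<^sub>M lborel) (\<lambda>(s, t). u_fun s t * h' t * vderiv \<phi> s)"
  proof (rule Bochner_Integration.integrable_bound[OF bw])
    show "(\<lambda>(s, t). u_fun s t * h' t * vderiv \<phi> s) \<in> borel_measurable (lborel \<Otimes>\<^sub>M lborel)"
      by measurable
    have "norm (u_fun s t * h' t * vderiv \<phi> s) \<le> b s * w t" for s t
      using mult_right_mono[OF u_fun_times_bound[of s t h'] norm_ge_zero[of "vderiv \<phi> s"]]
      by (simp add: b_def w_def norm_mult mult_ac)
    then show "AE x in lborel \<Otimes>\<^sub>M lborel. norm (case x of (s, t) \<Rightarrow> u_fun s t * h' t * vderiv \<phi> s)
        \<le> norm (case x of (s, t) \<Rightarrow> b s * w t)"
      by (intro AE_I2) (auto simp: w0 b0 abs_mult)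
  qed
  have "dist_deriv (regular (Psi h)) \<phi> = - (LINT s|lebesgue. Psi h' s * vderiv \<phi> s)"
    using \<phi> Psi_cong_AE[OF tame_measurable[OF h] tame_measurable[OF h'(2)] h'(3)]
    by (simp add: dist_deriv_regular)
  also have "(LINT s|lebesgue. Psi h' s * vderiv \<phi> s) = (LINT s|lborel. Psi h' s * vderiv \<phi> s)"
    by (subst integral_completion) auto
  also have "\<dots> = (LINT s|lborel. LINT t|lborel. u_fun s t * h' t * vderiv \<phi> s)"
    unfolding Psi_eq_integral by (subst integral_completion) auto
  also have "\<dots> = (LINT t|lborel. LINT s|lborel. u_fun s t * h' t * vderiv \<phi> s)"
    using lborel_pair.Fubini_integral[OF F] by simp
  also have "\<dots> = (LINT t|lborel. - (h' t * (LINT s|lborel. iexp (- (s * t)) * \<phi> s)))"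
  proof (rule integral_cong_AE)
    have "(LINT s|lborel. u_fun s t * h' t * vderiv \<phi> s) = - (h' t * (LINT s|lborel. iexp (- (s * t)) * \<phi> s))"
      if "t \<noteq> 0" for t
    proof -
      have "(LINT s|lborel. u_fun s t * h' t * vderiv \<phi> s) = (LINT s|lborel. h' t * (u_fun s t * vderiv \<phi> s))"
        by (simp add: mult_ac)
      then show ?thesis using integral_u_fun_vderiv[OF \<phi> that] by simp
    qed
    then show "AE t in lborel. (LINT s|lborel. u_fun s t * h' t * vderiv \<phi> s)
        = - (h' t * (LINT s|lborel. iexp (- (s * t)) * \<phi> s))"
      by (intro eventually_mono[OF AE_lborel_singleton[of 0]])
  qed measurable
  also have "\<dots> = - (LINT t|lborel. h' t * (LINT s|lborel. iexp (- (s * t)) * \<phi> s))" by simp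
  also have "(LINT t|lborel. h' t * (LINT s|lborel. iexp (- (s * t)) * \<phi> s))
     = (LINT t|lebesgue. h' t * (LINT s|lborel. iexp (- (s * t)) * \<phi> s))"
    by (subst integral_completion) auto
  also have "\<dots> = (LINT t|lebesgue. h t * (LINT s|lborel. iexp (- (s * t)) * \<phi> s))"
  proof (rule integral_cong_AE)
    have m: "(\<lambda>t. LINT s|lborel. iexp (- (s * t)) * \<phi> s) \<in> borel_measurable lebesgue"
      by (rule measurable_completion) measurable
    show "(\<lambda>t. h' t * (LINT s|lborel. iexp (- (s * t)) * \<phi> s)) \<in> borel_measurable lebesgue"
      by (rule borel_measurable_times[OF tame_measurable[OF h'(2)] m])
    show "(\<lambda>t. h t * (LINT s|lborel. iexp (- (s * t)) * \<phi> s)) \<in> borel_measurable lebesgue"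
      by (rule borel_measurable_times[OF tame_measurable[OF h] m])
    show "AE t in lebesgue. h' t * (LINT s|lborel. iexp (- (s * t)) * \<phi> s)
        = h t * (LINT s|lborel. iexp (- (s * t)) * \<phi> s)"
      using h'(3) by eventually_elim simp
  qed
  finally show ?thesis by simp
qed

text \<open>Testing with the real parameter \<open>-u\<close> produces, up to the nonzero factor \<open>K\<close>, the pairing with the
  Gaussian modulated by \<open>u\<close>.\<close>

lemma dist_deriv_Psi_inject:
  assumes h: "tame h" and k: "tame k"
    and eq: "dist_deriv (regular (Psi h)) = dist_deriv (regular (Psi k))"
  shows "AE x in lebesgue. h x = k x"
proof -
  have d: "tame (\<lambda>x. h x - k x)" using h k by (rule tame_diff)
  have "AE x in lebesgue. h x - k x = 0"
  proof (rule tame_eq_0_if_gaussian_pairings_eq_0[OF d])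
    fix u
    define K where "K = complex_of_real (exp (u\<^sup>2 / 2) * sqrt (2 * pi))"
    let ?g = "gaussian (\<i> * complex_of_real u)"
    let ?G = "gaussian (complex_of_real (- u))"
    have T: "dist_deriv (regular (Psi f)) ?G = K * (LINT t|lebesgue. f t * ?g t)" if "tame f" for f
      unfolding dist_deriv_Psi_eq_integral_fourier[OF that gaussian_schwartz] fourier_integral_gaussian
      by (simp add: K_def mult.left_commute[of "f _"] flip: integral_mult_right_zero)
    have "(LINT t|lebesgue. (h t - k t) * ?g t) = (LINT t|lebesgue. h t * ?g t) - (LINT t|lebesgue. k t * ?g t)"
      using tame_schwartz_integrable[OF h gaussian_schwartz] tame_schwartz_integrable[OF k gaussian_schwartz]
      by (simp add: left_diff_distrib)
    moreover have "K \<noteq> 0" by (simp add: K_def)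
    ultimately show "(LINT t|lebesgue. (h t - k t) * ?g t) = 0"
      using T[OF h] T[OF k] eq by simp
  qed
  then show ?thesis by simp
qed

section \<open>The Fourier transform on variable Lebesgue spaces\<close>

lemma fourier_eq: "h \<in> fourier_domain \<Longrightarrow> fourier h = dist_deriv (regular (Psi h))"
  by (simp add: fourier_def)

lemma fourier_eq_iff_AE:
  assumes "h \<in> fourier_domain" "k \<in> fourier_domain"
  shows "fourier h = fourier k \<longleftrightarrow> (AE x in lebesgue. h x = k x)"
  using dist_deriv_Psi_inject[of h k] Psi_cong_AE[of h k] assms
  by (auto simp: fourier_eq fourier_domain_tame tame_measurable)

text \<open>The preimage chosen in the definition of the norm agrees with \<open>h\<close> almost everywhere by injectivity,
  and the norm of \<open>L\<^sup>p\<close> does not see null sets.\<close>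

lemma A_norm_fourier:
  assumes p: "admissible p" and h: "h \<in> Lp p"
  shows "A_norm p (fourier h) = Lp_norm p h"
proof -
  define k where "k = (SOME f. f \<in> Lp p \<and> dist_deriv (regular (Psi f)) = fourier h)"
  have "h \<in> Lp p \<and> dist_deriv (regular (Psi h)) = fourier h"
    using h fourier_domainI[OF p h] by (simp add: fourier_eq)
  then have k: "k \<in> Lp p \<and> dist_deriv (regular (Psi k)) = fourier h"
    unfolding k_def by (rule someI[of "\<lambda>f. f \<in> Lp p \<and> dist_deriv (regular (Psi f)) = fourier h"])
  then have "fourier k = fourier h" using fourier_domainI[OF p, of k] by (simp add: fourier_eq)
  then have "AE x in lebesgue. k x = h x"
    using fourier_domainI[OF p] k h by (simp add: fourier_eq_iff_AE)
  then have "Lp_norm p k = Lp_norm p h"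
    using p k h by (intro Lp_norm_cong_AE) (auto simp: admissible_def)
  then show ?thesis by (simp add: A_norm_def k_def)
qed

text \<open>The function chosen to represent the distribution is tame, so it agrees with \<open>h\<close> almost everywhere.\<close>

lemma fourier_dist_regular:
  assumes h: "h \<in> fourier_domain"
  shows "fourier_dist (regular h) = dist_deriv (regular (Psi h))"
proof -
  define k where "k = (SOME f. f \<in> fourier_domain \<and> regular f = regular h)"
  have k: "k \<in> fourier_domain \<and> regular k = regular h"
    unfolding k_def by (rule someI[of _ h]) (use h in simp)
  then have "AE x in lebesgue. k x = h x"
    using h by (intro regular_inject) (auto intro: fourier_domain_tame)
  then have "fourier k = fourier h" using k h by (simp add: fourier_eq_iff_AE)
  then show ?thesis using h by (simp add: fourier_dist_def k_def fourier_eq)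
qed

text \<open>A constant pairs with the derivative of a Schwartz function to \<open>0\<close>.\<close>

lemma dist_deriv_regular_add_const:
  assumes g: "\<And>\<phi>. \<phi> \<in> schwartz \<Longrightarrow> integrable lebesgue (\<lambda>s. g s * \<phi> s)"
  shows "dist_deriv (regular (\<lambda>s. g s + c)) = dist_deriv (regular g)"
proof (rule ext)
  fix \<phi>
  show "dist_deriv (regular (\<lambda>s. g s + c)) \<phi> = dist_deriv (regular g) \<phi>"
  proof (cases "\<phi> \<in> schwartz")
    case True
    then have d: "vderiv \<phi> \<in> schwartz" by (rule schwartz_vderiv)
    have i: "integrable lebesgue (vderiv \<phi>)"
      using schwartz_integrable[OF d] schwartz_measurable[OF d] by (simp add: integrable_completion)
    have "(LINT s|lebesgue. (g s + c) * vderiv \<phi> s) = (LINT s|lebesgue. g s * vderiv \<phi> s + c * vderiv \<phi> s)"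
      by (simp add: algebra_simps)
    also have "\<dots> = (LINT s|lebesgue. g s * vderiv \<phi> s) + c * (LINT s|lebesgue. vderiv \<phi> s)"
      using g[OF d] i by simp
    finally show ?thesis using True integral_vderiv_schwartz[OF True] by (simp add: dist_deriv_regular)
  qed (simp add: dist_deriv_regular)
qed

lemma modulation_fourier_domain:
  assumes "h \<in> fourier_domain"
  shows "(\<lambda>t. exp (\<i> * complex_of_real a * complex_of_real t) * h t) \<in> fourier_domain"
proof -
  obtain p where p: "admissible p" "h \<in> Lp p" using assms by (auto simp: fourier_domain_def)
  have e: "(\<lambda>t. exp (\<i> * complex_of_real a * complex_of_real t)) \<in> borel_measurable lebesgue"
    by (rule measurable_completion) measurable
  have "(\<lambda>t. exp (\<i> * complex_of_real a * complex_of_real t) * h t) \<in> Lp p"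
  proof (rule Lp_cong_norm[OF p(2)])
    show "(\<lambda>t. exp (\<i> * complex_of_real a * complex_of_real t) * h t) \<in> borel_measurable lebesgue"
      by (rule borel_measurable_times[OF e Lp_measurable[OF p(2)]])
    show "norm (exp (\<i> * complex_of_real a * complex_of_real x) * h x) = norm (h x)" for x
      by (simp add: norm_mult)
  qed
  then show ?thesis by (rule fourier_domainI[OF p(1)])
qed

lemma fourier_modulation:
  assumes h: "h \<in> fourier_domain"
  shows "fourier (\<lambda>t. exp (\<i> * complex_of_real a * complex_of_real t) * h t)
       = dist_deriv (regular (translate a (Psi h)))"
proof -
  let ?F = "\<lambda>t. exp (\<i> * complex_of_real a * complex_of_real t) * h t"
  have F: "?F \<in> fourier_domain" using h by (rule modulation_fourier_domain)
  have "translate a (Psi h) = (\<lambda>s. Psi ?F s + Psi h (- a))"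
    using Psi_modulate[OF fourier_domain_tame[OF h], of a] by auto
  then show ?thesis
    using dist_deriv_regular_add_const[OF Psi_schwartz_integrable[OF fourier_domain_tame[OF F]], of "Psi h (- a)"]
    by (simp add: fourier_eq[OF F])
qed

lemma fourier_linear_combination:
  assumes hk: "h \<in> fourier_domain" "k \<in> fourier_domain" "(\<lambda>x. c * h x + d * k x) \<in> fourier_domain"
  shows "fourier (\<lambda>x. c * h x + d * k x) = (\<lambda>\<phi>. c * fourier h \<phi> + d * fourier k \<phi>)"
proof (rule ext)
  fix \<phi>
  note t = hk(1,2)[THEN fourier_domain_tame]
  show "fourier (\<lambda>x. c * h x + d * k x) \<phi> = c * fourier h \<phi> + d * fourier k \<phi>"
  proof (cases "\<phi> \<in> schwartz")
    case True
    then have v: "vderiv \<phi> \<in> schwartz" by (rule schwartz_vderiv)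
    have "(LINT s|lebesgue. Psi (\<lambda>x. c * h x + d * k x) s * vderiv \<phi> s)
        = (LINT s|lebesgue. c * (Psi h s * vderiv \<phi> s) + d * (Psi k s * vderiv \<phi> s))"
      by (simp add: Psi_linear_combination[OF t] algebra_simps)
    also have "\<dots> = c * (LINT s|lebesgue. Psi h s * vderiv \<phi> s) + d * (LINT s|lebesgue. Psi k s * vderiv \<phi> s)"
      using Psi_schwartz_integrable[OF t(1) v] Psi_schwartz_integrable[OF t(2) v] by simp
    finally show ?thesis using True hk by (simp add: fourier_eq dist_deriv_regular)
  qed (use hk in \<open>simp add: fourier_eq dist_deriv_regular\<close>)
qed

theorem proposition5p4:
  fixes p :: "real \<Rightarrow> ennreal" and f :: "real \<Rightarrow> complex"
  assumes p: "p \<in> exponents"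
    and p_cond: "esssup lebesgue p < \<infinity> \<or> log_holder_at_infinity_1 p"
    and f: "f \<in> Lp p"
  shows
    "((\<forall>h\<in>Lp p.
        (\<forall>s. s \<noteq> 0 \<longrightarrow> integrable lebesgue (\<lambda>t. u_fun s t * h t)) \<and>
        (\<forall>\<phi>\<in>schwartz. integrable lebesgue (\<lambda>s. Psi h s * \<phi> s)))
     \<and> A_space p \<subseteq> tempered_distributions
     \<and> (\<forall>h\<in>Lp p. \<forall>k\<in>Lp p. \<forall>c d.
          (\<lambda>x. c * h x + d * k x) \<in> Lp p \<and>
          fourier (\<lambda>x. c * h x + d * k x) = (\<lambda>\<phi>. c * fourier h \<phi> + d * fourier k \<phi>))
     \<and> fourier ` Lp p = A_space p
     \<and> (\<forall>h\<in>Lp p. \<forall>k\<in>Lp p. fourier h = fourier k \<longleftrightarrow> (AE x in lebesgue. h x = k x))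
     \<and> (\<exists>K>0. \<forall>h\<in>Lp p. A_norm p (fourier h) \<le> K * Lp_norm p h \<and>
                        Lp_norm p h \<le> K * A_norm p (fourier h))
     \<and> (\<forall>h\<in>Lp p. A_norm p (fourier h) = Lp_norm p h))
    \<and> (\<forall>n. (dist_deriv ^^ n) (fourier f) = (dist_deriv ^^ (n + 1)) (regular (Psi f)))
    \<and> (\<forall>a. translate a f \<in> fourier_domain
       \<and> fourier (translate a f) = dist_deriv (regular (Psi (translate a f)))
       \<and> (\<forall>s. s \<noteq> 0 \<longrightarrow> Psi (translate a f) s = conv f (reflect (u_fun s)) (- a)))
    \<and> (\<forall>a. (\<lambda>t. exp (\<i> * complex_of_real a * complex_of_real t) * f t) \<in> fourier_domain
       \<and> fourier (\<lambda>t. exp (\<i> * complex_of_real a * complex_of_real t) * f t)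
           = dist_deriv (regular (translate a (Psi f))))
    \<and> (reflect f \<in> fourier_domain
       \<and> fourier (reflect f) = dist_deriv (regular (Psi (reflect f)))
       \<and> Psi (reflect f) = (\<lambda>s. - reflect (Psi f) s))
    \<and> (\<forall>r h. r \<in> exponents \<and> (esssup lebesgue r < \<infinity> \<or> log_holder_at_infinity_1 r)
         \<and> h \<in> Lp r \<and> fourier f = regular h
       \<longrightarrow> fourier_dist (fourier f) = dist_deriv (regular (Psi h)))
    \<and> (\<forall>a b. a \<noteq> 0 \<longrightarrow>
       (\<lambda>x. f (a * x + b)) \<in> fourier_domain
       \<and> fourier (\<lambda>x. f (a * x + b)) = dist_deriv (regular (Psi (\<lambda>x. f (a * x + b))))
       \<and> (\<forall>s. Psi (\<lambda>x. f (a * x + b)) s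
              = complex_of_real (sgn a) * Psi (translate (- b) f) (s / a)))"
proof (intro conjI allI impI ballI)
  have adm: "admissible p" using p p_cond by (simp add: admissible_def)
  note dom = fourier_domainI[OF adm]
  note fd = dom[OF f]
  show "integrable lebesgue (\<lambda>t. u_fun s t * h t)" if "h \<in> Lp p" for h s
    using Psi_integrand_integrable[OF Lp_imp_tame[OF adm that]] .
  show "integrable lebesgue (\<lambda>s. Psi h s * \<phi> s)" if "h \<in> Lp p" "\<phi> \<in> schwartz" for h \<phi>
    using Psi_schwartz_integrable[OF Lp_imp_tame[OF adm]] that by blast
  show "A_space p \<subseteq> tempered_distributions"
    using tempered_dist_deriv_Psi Lp_imp_tame[OF adm] by (auto simp: A_space_def)
  show lin: "(\<lambda>x. c * h x + d * k x) \<in> Lp p" if "h \<in> Lp p" "k \<in> Lp p" for h k c d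
    using Lp_linear_combination[OF p] that by blast
  show "fourier (\<lambda>x. c * h x + d * k x) = (\<lambda>\<phi>. c * fourier h \<phi> + d * fourier k \<phi>)"
    if "h \<in> Lp p" "k \<in> Lp p" for h k c d
    using fourier_linear_combination dom lin that by blast
  show "fourier ` Lp p = A_space p"
    using dom by (auto simp: A_space_def fourier_eq image_iff)
  show "(fourier h = fourier k) = (AE x in lebesgue. h x = k x)" if "h \<in> Lp p" "k \<in> Lp p" for h k
    using fourier_eq_iff_AE dom that by blast
  show iso: "A_norm p (fourier h) = Lp_norm p h" if "h \<in> Lp p" for h
    using A_norm_fourier[OF adm that] .
  show "\<exists>K>0. \<forall>h\<in>Lp p. A_norm p (fourier h) \<le> K * Lp_norm p h \<and> Lp_norm p h \<le> K * A_norm p (fourier h)"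
    by (rule exI[of _ 1]) (simp add: iso)
  show "(dist_deriv ^^ n) (fourier f) = (dist_deriv ^^ (n + 1)) (regular (Psi f))" for n
    by (simp add: fourier_eq[OF fd] funpow_swap1)
  have aff: "(\<lambda>x. f (a * x + b)) \<in> fourier_domain" if "a \<noteq> 0" for a b
    using that fd by (rule fourier_domain_affine)
  show tr: "translate a f \<in> fourier_domain" for a
    using aff[of 1 "- a"] by (simp add: translate_def)
  show "fourier (translate a f) = dist_deriv (regular (Psi (translate a f)))" for a
    by (rule fourier_eq[OF tr])
  show "Psi (translate a f) s = conv f (reflect (u_fun s)) (- a)" for a s
    by (rule Psi_translate)
  show "(\<lambda>t. exp (\<i> * complex_of_real a * complex_of_real t) * f t) \<in> fourier_domain" for a
    by (rule modulation_fourier_domain[OF fd])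
  show "fourier (\<lambda>t. exp (\<i> * complex_of_real a * complex_of_real t) * f t)
     = dist_deriv (regular (translate a (Psi f)))" for a
    by (rule fourier_modulation[OF fd])
  show rf: "reflect f \<in> fourier_domain"
    using aff[of "-1" 0] by (simp add: reflect_def)
  show "fourier (reflect f) = dist_deriv (regular (Psi (reflect f)))"
    by (rule fourier_eq[OF rf])
  show "Psi (reflect f) = (\<lambda>s. - reflect (Psi f) s)"
    by (rule Psi_reflect)
  show "fourier_dist (fourier f) = dist_deriv (regular (Psi h))"
    if "r \<in> exponents \<and> (esssup lebesgue r < \<infinity> \<or> log_holder_at_infinity_1 r)
         \<and> h \<in> Lp r \<and> fourier f = regular h" for r h
    using that fourier_dist_regular[OF fourier_domainI[of r h]] by (simp add: admissible_def)
  show "(\<lambda>x. f (a * x + b)) \<in> fourier_domain" if "a \<noteq> 0" for a b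
    using that by (rule aff)
  show "fourier (\<lambda>x. f (a * x + b)) = dist_deriv (regular (Psi (\<lambda>x. f (a * x + b))))" if "a \<noteq> 0" for a b
    by (rule fourier_eq[OF aff[OF that]])
  show "Psi (\<lambda>x. f (a * x + b)) s = complex_of_real (sgn a) * Psi (translate (- b) f) (s / a)"
    if "a \<noteq> 0" for a b s
    using that by (rule Psi_affine)
qed

end
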